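(* Let $G$ be a tree. Then $G$ enjoys the strong exchange property if and only if one of the following holds: (i) $G=P_6$, the path on $6$ vertices; (ii) $G$ is obtained from a star graph by attaching at most one pendant edge to each of its leaves.
   Context: All graphs are finite with no loop, no multiple edge and no isolated vertex. Let $G$ be such a graph on $V(G)=\{x_1,\ldots,x_n\}$ with edge set $E(G)$, and let $S=K[x_1,\ldots,x_n]$ be the polynomial ring over a field $K$. The edge ideal $I(G)\subset S$ is generated by the monomials $x_ix_j$ with $\{x_i,x_j\}\in E(G)$. For a monomial ideal $I\subset S$ and $\mathfrak{c}=(c_1,\ldots,c_n)\in\mathbb{Z}_{>0}^n$, $I_{\mathfrak{c}}$ is the ideal generated by the monomials $x_1^{a_1}\cdots x_n^{a_n}\in I$ with $a_i\le c_i$ for all $i$, and $\delta_{\mathfrak{c}}(I)$ is the largest integer $q$ with $(I^q)_{\mathfrak{c}}\neq 0$. Let $\mathcal{W}(\mathfrak{c},G)$ be the minimal set of monomial generators of $(I(G)^{\delta})_{\mathfrak{c}}$, where $\delta=\delta_{\mathfrak{c}}(I(G))$. $\mathcal{W}(\mathfrak{c},G)$ enjoys the strong exchange property if for all $w=x_1^{a_1}\cdots x_n^{a_n}$ and $w'=x_1^{b_1}\cdots x_n^{b_n}$ in $\mathcal{W}(\mathfrak{c},G)$ and all $\xi,\rho$ with $a_\xi>b_\xi$ and $a_\rho<b_\rho$, one has $x_\rho(w/x_\xi)\in\mathcal{W}(\mathfrak{c},G)$. The graph $G$ enjoys the strong exchange property if $\mathcal{W}(\mathfrak{c},G)$ does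 for every $\mathfrak{c}\in\mathbb{Z}_{>0}^n$. A tree is a finite connected graph with no cycle. A leaf is a vertex of degree one. A star graph on $m+1$ vertices ($m\ge 1$) has vertices $x_1,\ldots,x_{m+1}$ and edges $\{x_i,x_{m+1}\}$, $1\le i\le m$. Attaching a pendant edge to a vertex $v$ means adding a new vertex $y$ and the edge $\{v,y\}$. Equality of graphs is understood up to isomorphism. *)

theory Defs
  imports "HOL-Library.Poly_Mapping" "HOL-Algebra.Ideal_Product"
begin

section \<open>Graphs\<close>

record 'v ugraph =
  verts :: "'v set"
  edges :: "'v set set"

definition simple_graph :: "'v ugraph \<Rightarrow> bool" where
  "simple_graph G \<longleftrightarrow>
     finite (verts G) \<and>
     (\<forall>e\<in>edges G. e \<subseteq> verts G \<and> card e = 2) \<and>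
     (\<forall>v\<in>verts G. \<exists>e\<in>edges G. v \<in> e)"

text \<open>A connected graph is understood to have at least one vertex.\<close>

definition connected_graph :: "'v ugraph \<Rightarrow> bool" where
  "connected_graph G \<longleftrightarrow>
     verts G \<noteq> {} \<and>
     (\<forall>u\<in>verts G. \<forall>v\<in>verts G. (u, v) \<in> {(x, y). {x, y} \<in> edges G}\<^sup>*)"

definition is_cycle :: "'v ugraph \<Rightarrow> 'v list \<Rightarrow> bool" where
  "is_cycle G p \<longleftrightarrow>
     3 \<le> length p \<and> distinct p \<and> set p \<subseteq> verts G \<and>
     (\<forall>i<length p. {p ! i, p ! (Suc i mod length p)} \<in> edges G)"

definition tree :: "'v ugraph \<Rightarrow> bool" where
  "tree G \<longleftrightarrow> simple_graph G \<and> connected_graph G \<and> \<not> (\<exists>p. is_cycle G p)"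

definition degree :: "'v ugraph \<Rightarrow> 'v \<Rightarrow> nat" where
  "degree G v = card {e \<in> edges G. v \<in> e}"

definition leaves :: "'v ugraph \<Rightarrow> 'v set" where
  "leaves G = {v \<in> verts G. degree G v = 1}"

definition graph_iso :: "'v ugraph \<Rightarrow> 'w ugraph \<Rightarrow> bool" where
  "graph_iso G H \<longleftrightarrow> (\<exists>f. bij_betw f (verts G) (verts H) \<and> (\<lambda>e. f ` e) ` edges G = edges H)"

definition path_graph :: "nat \<Rightarrow> nat ugraph" where
  "path_graph n = \<lparr>verts = {1..n}, edges = {{i, i + 1} | i. 1 \<le> i \<and> i < n}\<rparr>"

definition star_graph :: "nat \<Rightarrow> nat ugraph" where
  "star_graph m = \<lparr>verts = {1..m + 1}, edges = {{i, m + 1} | i. 1 \<le> i \<and> i \<le> m}\<rparr>"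

text \<open>One pendant edge is attached to every vertex of \<open>L\<close>: \<open>Inl v\<close> is the old vertex \<open>v\<close>,
  and \<open>Inr v\<close> is the new vertex joined to it.\<close>

definition attach_pendants :: "'v ugraph \<Rightarrow> 'v set \<Rightarrow> ('v + 'v) ugraph" where
  "attach_pendants G L =
     \<lparr>verts = Inl ` verts G \<union> Inr ` L,
      edges = (\<lambda>e. Inl ` e) ` edges G \<union> {{Inl v, Inr v} | v. v \<in> L}\<rparr>"


section \<open>Polynomial rings and monomial ideals\<close>

text \<open>A polynomial is a finitely supported map from exponent vectors to coefficients;
  \<open>poly_ring V\<close> is the ring of the polynomials in the variables from \<open>V\<close> only.\<close>

type_synonym ('v, 'k) mpoly = "('v \<Rightarrow>\<^sub>0 nat) \<Rightarrow>\<^sub>0 'k"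

definition poly_ring :: "'v set \<Rightarrow> ('v, 'k::field) mpoly ring" where
  "poly_ring V =
     \<lparr>carrier = {p. \<forall>a\<in>Poly_Mapping.keys p. Poly_Mapping.keys a \<subseteq> V},
      mult = (*), one = 1, zero = 0, add = (+)\<rparr>"

definition mono_of :: "('v \<Rightarrow>\<^sub>0 nat) \<Rightarrow> ('v, 'k::field) mpoly" where
  "mono_of a = Poly_Mapping.single a 1"

definition monomials :: "'v set \<Rightarrow> ('v, 'k::field) mpoly set" where
  "monomials V = {mono_of a | a. Poly_Mapping.keys a \<subseteq> V}"

definition edge_ideal :: "'v ugraph \<Rightarrow> ('v, 'k::field) mpoly set" where
  "edge_ideal G =
     Idl\<^bsub>poly_ring (verts G)\<^esub>
       {mono_of (Poly_Mapping.single u 1 + Poly_Mapping.single v 1) | u v. {u, v} \<in> edges G}"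

text \<open>Powers are taken in the multiplicative monoid of ideals, so the power with exponent
  \<open>0\<close> is the whole ring.\<close>

definition ideal_pow :: "'v set \<Rightarrow> ('v, 'k::field) mpoly set \<Rightarrow> nat \<Rightarrow> ('v, 'k) mpoly set" where
  "ideal_pow V I q = I [^]\<^bsub>ideals_set (poly_ring V)\<^esub> q"

definition bounded_ideal ::
    "'v set \<Rightarrow> ('v \<Rightarrow> nat) \<Rightarrow> ('v, 'k::field) mpoly set \<Rightarrow> ('v, 'k) mpoly set" where
  "bounded_ideal V c I =
     Idl\<^bsub>poly_ring V\<^esub>
       {mono_of a | a. mono_of a \<in> I \<and> (\<forall>v\<in>V. Poly_Mapping.lookup a v \<le> c v)}"

definition delta :: "'v set \<Rightarrow> ('v \<Rightarrow> nat) \<Rightarrow> ('v, 'k::field) mpoly set \<Rightarrow> nat" where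
  "delta V c I = (GREATEST q. bounded_ideal V c (ideal_pow V I q) \<noteq> {0})"

definition min_mono_gens :: "'v set \<Rightarrow> ('v, 'k::field) mpoly set \<Rightarrow> ('v, 'k) mpoly set" where
  "min_mono_gens V J =
     (THE M. M \<subseteq> monomials V \<and> Idl\<^bsub>poly_ring V\<^esub> M = J \<and>
             (\<forall>M'. M' \<subset> M \<longrightarrow> Idl\<^bsub>poly_ring V\<^esub> M' \<noteq> J))"

definition W_gens :: "('v \<Rightarrow> nat) \<Rightarrow> 'v ugraph \<Rightarrow> ('v, 'k::field) mpoly set" where
  "W_gens c G =
     (let V = verts G; I = edge_ideal G
      in min_mono_gens V (bounded_ideal V c (ideal_pow V I (delta V c I))))"


section \<open>The strong exchange property\<close>

text \<open>Subtraction of exponent vectors is truncated, but here \<open>x\<^sub>\<xi>\<close> divides \<open>w\<close>.\<close>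

definition strong_exchange :: "('v, 'k::field) mpoly set \<Rightarrow> bool" where
  "strong_exchange W \<longleftrightarrow>
     (\<forall>a b \<xi> \<rho>. mono_of a \<in> W \<longrightarrow> mono_of b \<in> W \<longrightarrow>
        Poly_Mapping.lookup a \<xi> > Poly_Mapping.lookup b \<xi> \<longrightarrow>
        Poly_Mapping.lookup a \<rho> < Poly_Mapping.lookup b \<rho> \<longrightarrow>
        mono_of (Poly_Mapping.single \<rho> 1 + (a - Poly_Mapping.single \<xi> 1)) \<in> W)"

text \<open>The type argument is the coefficient field.\<close>

definition strong_exchange_graph :: "'k::field itself \<Rightarrow> 'v ugraph \<Rightarrow> bool" where
  "strong_exchange_graph K G \<longleftrightarrow>
     (\<forall>c. (\<forall>v\<in>verts G. c v > 0) \<longrightarrow> strong_exchange (W_gens c G :: ('v, 'k) mpoly set))"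

end

theory Submission
  imports Defs "HOL-Library.Multiset"
begin

text \<open>The set \<open>W_gens c G\<close> consists of the monomials whose exponent vectors are the
  degree vectors of the maximum matchings of \<open>G\<close> with capacities \<open>c\<close>,
  where a matching is a multiset of edges that meets each vertex \<open>v\<close> at most
  \<open>c v\<close> times (\<open>W_gens_eq\<close>): all of them have the same degree, so they
  form an antichain for divisibility and are the minimal generators. The theorem thus becomes a
  statement about degree vectors of maximum matchings, in which the field does not occur
  (\<open>strong_exchange_graph_iff\<close>).

  For the necessity of the conditions, let all vertices of a maximal independent set
  \<open>I\<close> have large capacity and the vertices of its complement capacity one. The
  maximum matchings then match each vertex outside \<open>I\<close> to some neighbour in
  \<open>I\<close>. An edge of the tree splits it into two parts, and the vertices of one part
  that are forced to be matched within this part give a lower bound on the degree there. If this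
  bound is attained and both parts contain a vertex with a choice between two partners, then an
  exchange across the edge violates the bound (\<open>exchange_obstruction\<close>). Avoiding
  this obstruction leaves little freedom. Around a vertex of degree at least three, every branch
  is a single vertex or a single edge (\<open>spider_of_branching\<close>), so the tree is a
  star with some pendant edges attached to its leaves. A tree without such a vertex is a path,
  and a path with seven vertices contains the obstruction (\<open>path_length_le_six\<close>).
  Paths with at most five vertices again are stars with pendant edges, which leaves the path
  with six vertices.

  For the sufficiency, tight vertex covers are used. Once a cover with total capacity equal to
  the size of a maximum matching is known, every maximum matching saturates it and uses no edge
  inside it (\<open>cover_tight\<close>). For the graphs in question this fixes all degrees in
  one of the two colour classes, and inside the other class an exchange from
  \<open>\<xi>\<close> to \<open>\<rho>\<close> is performed by alternately removing and adding
  the edges of the path between them, which has two or four edges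
  (\<open>exchange_spider\<close>, \<open>path6_exchange\<close>).\<close>

section \<open>Monomial ideals\<close>

lemma keys_add_nat: "Poly_Mapping.keys (a + b :: 'v \<Rightarrow>\<^sub>0 nat) = Poly_Mapping.keys a \<union> Poly_Mapping.keys b"
  by (auto simp: in_keys_iff lookup_add)

lemma poly_ring_carrier:
  "carrier (poly_ring V :: ('v, 'k::field) mpoly ring) = {p. \<forall>a\<in>Poly_Mapping.keys p. Poly_Mapping.keys a \<subseteq> V}"
  by (simp add: poly_ring_def)

lemma poly_ring_ops:
  "x \<otimes>\<^bsub>poly_ring V\<^esub> y = x * y" "\<one>\<^bsub>poly_ring V\<^esub> = 1"
  "\<zero>\<^bsub>poly_ring V\<^esub> = 0" "x \<oplus>\<^bsub>poly_ring V\<^esub> y = x + y"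
  for x y :: "('v, 'k::field) mpoly"
  by (simp_all add: poly_ring_def)

lemmas poly_ring_simps = poly_ring_carrier poly_ring_ops

lemma cring_poly_ring: "cring (poly_ring V :: ('v, 'k::field) mpoly ring)"
proof -
  let ?R = "poly_ring V :: ('v, 'k) mpoly ring"
  have "Poly_Mapping.keys a \<subseteq> V" if xy: "\<forall>a\<in>Poly_Mapping.keys x. Poly_Mapping.keys a \<subseteq> V"
     "\<forall>a\<in>Poly_Mapping.keys y. Poly_Mapping.keys a \<subseteq> V"
      "a \<in> Poly_Mapping.keys (x * y)" for x y :: "('v, 'k) mpoly" and a
  proof -
    obtain b c where "a = b + c" "b \<in> Poly_Mapping.keys x" "c \<in> Poly_Mapping.keys y"
      using xy(3) keys_mult[of x y] by blast
    then show ?thesis using xy(1,2) by (simp add: keys_add_nat)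
  qed
  then have mult: "x * y \<in> carrier ?R" if "x \<in> carrier ?R" "y \<in> carrier ?R" for x y
    using that unfolding poly_ring_carrier by blast
  have add: "x + y \<in> carrier ?R" if "x \<in> carrier ?R" "y \<in> carrier ?R" for x y
    using that keys_add[of x y] unfolding poly_ring_carrier by blast
  have inv: "\<exists>y\<in>carrier ?R. y + x = 0" if "x \<in> carrier ?R" for x
    using that by (intro bexI[of _ "- x"]) (simp_all add: poly_ring_simps)
  have zero: "0 \<in> carrier ?R" and one: "1 \<in> carrier ?R" by (simp_all add: poly_ring_simps)
  have "abelian_group ?R"
  proof (rule abelian_groupI, goal_cases)
    case (1 x y) then show ?case using add[of x y] by (simp only: poly_ring_ops)
  next case 2 show ?case using zero by (simp only: poly_ring_ops)
  next case (3 x y z) show ?case by (simp only: poly_ring_ops add.assoc)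
  next case (4 x y) show ?case by (simp only: poly_ring_ops add.commute)
  next case (5 x) show ?case by (simp only: poly_ring_ops add_0_left)
  next case (6 x) then show ?case using inv[of x] by (simp only: poly_ring_ops)
  qed
  moreover have "comm_monoid ?R"
  proof (rule comm_monoidI, goal_cases)
    case (1 x y) then show ?case using mult[of x y] by (simp only: poly_ring_ops)
  next case 2 show ?case using one by (simp only: poly_ring_ops)
  next case (3 x y z) show ?case by (simp only: poly_ring_ops mult.assoc)
  next case (4 x) show ?case by (simp only: poly_ring_ops mult_1_left)
  next case (5 x y) show ?case by (simp only: poly_ring_ops mult.commute)
  qed
  ultimately show ?thesis
    by (rule cringI) (simp add: poly_ring_ops distrib_right)
qed

lemma poly_ring_a_inv:
  fixes p :: "('v, 'k::field) mpoly"
  assumes "p \<in> carrier (poly_ring V)"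
  shows "\<ominus>\<^bsub>poly_ring V\<^esub> p = - p"
proof -
  interpret cring "poly_ring V :: ('v, 'k) mpoly ring" by (rule cring_poly_ring)
  show ?thesis
    by (rule minus_equality) (use assms in \<open>simp_all add: poly_ring_simps\<close>)
qed

text \<open>For exponent vectors \<open>A\<close> in the variables \<open>V\<close>, this is the monomial
  ideal generated by \<open>A\<close>, described by the supports of its elements instead of as
  an intersection of ideals: this turns membership of a monomial into divisibility by a
  generator.\<close>
definition upset_ideal :: "'v set \<Rightarrow> ('v \<Rightarrow>\<^sub>0 nat) set \<Rightarrow> ('v, 'k::field) mpoly set" where
  "upset_ideal V A = {p. \<forall>m\<in>Poly_Mapping.keys p. Poly_Mapping.keys m \<subseteq> V \<and> (\<exists>a\<in>A. \<exists>t. m = a + t)}"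

lemma ideal_upset_ideal: "ideal (upset_ideal V A :: ('v, 'k::field) mpoly set) (poly_ring V)"
proof -
  let ?R = "poly_ring V :: ('v, 'k) mpoly ring"
  interpret R: cring ?R by (rule cring_poly_ring)
  have sub: "upset_ideal V A \<subseteq> carrier ?R"
    by (auto simp: upset_ideal_def poly_ring_simps)
  have mult: "x * p \<in> upset_ideal V A" if px: "p \<in> upset_ideal V A" "x \<in> carrier ?R" for x p
    unfolding upset_ideal_def
  proof (intro CollectI ballI)
    fix m assume "m \<in> Poly_Mapping.keys (x * p)"
    then obtain b c where m: "m = b + c" "b \<in> Poly_Mapping.keys x" "c \<in> Poly_Mapping.keys p"
      using keys_mult[of x p] by blast
    then obtain a t where "a \<in> A" "c = a + t" "Poly_Mapping.keys c \<subseteq> V"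
      using px(1) unfolding upset_ideal_def by blast
    then show "Poly_Mapping.keys m \<subseteq> V \<and> (\<exists>a\<in>A. \<exists>t. m = a + t)"
      using m px(2) by (auto simp: keys_add_nat poly_ring_simps ac_simps intro!: bexI[of _ a] exI[of _ "b + t"])
  qed
  show ?thesis
  proof (rule idealI)
    show "ring ?R" ..
    show "subgroup (upset_ideal V A) (add_monoid ?R)"
    proof (rule group.subgroupI)
      show "Group.group (add_monoid ?R)" by (rule R.a_group)
      show "upset_ideal V A \<subseteq> carrier (add_monoid ?R)" using sub by simp
      have "0 \<in> upset_ideal V A" by (simp add: upset_ideal_def)
      then show "upset_ideal V A \<noteq> {}" by blast
    next
      fix p :: "('v, 'k) mpoly" assume p: "p \<in> upset_ideal V A"
      have "- p \<in> upset_ideal V A" using p by (simp add: upset_ideal_def)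
      then show "inv\<^bsub>add_monoid ?R\<^esub> p \<in> upset_ideal V A"
        using poly_ring_a_inv[of p V] p sub by (auto simp: a_inv_def)
    next
      fix p q :: "('v, 'k) mpoly" assume "p \<in> upset_ideal V A" "q \<in> upset_ideal V A"
      then show "p \<otimes>\<^bsub>add_monoid ?R\<^esub> q \<in> upset_ideal V A"
        using keys_add[of p q] by (auto simp: upset_ideal_def poly_ring_simps)
    qed
  next
    fix a x :: "('v, 'k) mpoly" assume "a \<in> upset_ideal V A" "x \<in> carrier ?R"
    then show "x \<otimes>\<^bsub>?R\<^esub> a \<in> upset_ideal V A" "a \<otimes>\<^bsub>?R\<^esub> x \<in> upset_ideal V A"
      using mult[of a x] by (simp_all add: poly_ring_simps mult.commute)
  qed
qed

lemma sum_monomials: "p = (\<Sum>m\<in>Poly_Mapping.keys p. Poly_Mapping.single m (Poly_Mapping.lookup p m))"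
  by (rule poly_mapping_eqI) (simp add: lookup_sum lookup_single when_def in_keys_iff)

lemma upset_ideal_least:
  fixes J :: "('v, 'k::field) mpoly set"
  assumes "ideal J (poly_ring V)" "\<And>a. a \<in> A \<Longrightarrow> mono_of a \<in> J"
  shows "upset_ideal V A \<subseteq> J"
proof
  fix p :: "('v, 'k) mpoly" assume p: "p \<in> upset_ideal V A"
  interpret J: ideal J "poly_ring V" by fact
  have "(\<Sum>m\<in>S. Poly_Mapping.single m (Poly_Mapping.lookup p m)) \<in> J" if "finite S" "S \<subseteq> Poly_Mapping.keys p" for S
    using that
  proof (induction S)
    case empty
    show ?case using additive_subgroup.zero_closed[OF J.is_additive_subgroup] by (simp add: poly_ring_simps)
  next
    case (insert m S)
    then obtain a t where a: "a \<in> A" "m = a + t" "Poly_Mapping.keys m \<subseteq> V"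
      using p unfolding upset_ideal_def by blast
    have "Poly_Mapping.single t (Poly_Mapping.lookup p m) \<otimes>\<^bsub>poly_ring V\<^esub> mono_of a \<in> J"
      using a by (intro J.I_l_closed assms(2)) (simp_all add: poly_ring_simps keys_add_nat)
    then have "Poly_Mapping.single m (Poly_Mapping.lookup p m) \<in> J"
      using a by (simp add: poly_ring_simps mono_of_def mult_single add.commute)
    then show ?case
      using insert additive_subgroup.a_closed[OF J.is_additive_subgroup, of "Poly_Mapping.single m (Poly_Mapping.lookup p m)"]
      by (simp add: poly_ring_simps)
  qed
  from this[of "Poly_Mapping.keys p"] show "p \<in> J"
    using sum_monomials[of p] by simp
qed

lemma mono_of_in_upset_ideal:
  "(mono_of a :: ('v, 'k::field) mpoly) \<in> upset_ideal V A \<longleftrightarrow>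
     Poly_Mapping.keys a \<subseteq> V \<and> (\<exists>b\<in>A. \<exists>t. a = b + t)"
  by (simp add: mono_of_def upset_ideal_def)

lemma genideal_monomials:
  assumes "\<And>a. a \<in> A \<Longrightarrow> Poly_Mapping.keys a \<subseteq> V"
  shows "Idl\<^bsub>poly_ring V\<^esub> (mono_of ` A) = (upset_ideal V A :: ('v, 'k::field) mpoly set)"
proof
  interpret R: cring "poly_ring V :: ('v, 'k) mpoly ring" by (rule cring_poly_ring)
  have "mono_of ` A \<subseteq> (upset_ideal V A :: ('v, 'k::field) mpoly set)"
    using assms by (fastforce simp: mono_of_in_upset_ideal intro!: exI[of _ 0])
  then show "Idl\<^bsub>poly_ring V\<^esub> (mono_of ` A) \<subseteq> (upset_ideal V A :: ('v, 'k::field) mpoly set)"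
    by (intro R.genideal_minimal ideal_upset_ideal)
  have "mono_of ` A \<subseteq> carrier (poly_ring V :: ('v, 'k) mpoly ring)"
    using assms by (fastforce simp: poly_ring_simps mono_of_def)
  then show "upset_ideal V A \<subseteq> (Idl\<^bsub>poly_ring V\<^esub> (mono_of ` A) :: ('v, 'k::field) mpoly set)"
    using R.genideal_ideal R.genideal_self by (intro upset_ideal_least) blast+
qed

text \<open>Every term of a product of two polynomials is a product of terms, which gives one inclusion;
  the other one holds because the products of generators lie in the product ideal.\<close>
lemma ideal_prod_upset_ideal:
  assumes "\<And>a. a \<in> A \<Longrightarrow> Poly_Mapping.keys a \<subseteq> V" "\<And>b. b \<in> B \<Longrightarrow> Poly_Mapping.keys b \<subseteq> V"
  shows "upset_ideal V A \<cdot>\<^bsub>poly_ring V\<^esub> upset_ideal V B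
           = (upset_ideal V {a + b | a b. a \<in> A \<and> b \<in> B} :: ('v, 'k::field) mpoly set)"
    (is "?P = ?Q")
proof
  interpret R: cring "poly_ring V :: ('v, 'k) mpoly ring" by (rule cring_poly_ring)
  interpret Q: ideal ?Q "poly_ring V :: ('v, 'k) mpoly ring" by (rule ideal_upset_ideal)
  show "?P \<subseteq> ?Q"
  proof
    fix s assume "s \<in> ?P"
    then show "s \<in> ?Q"
    proof (induction rule: ideal_prod.induct)
      case (prod p q)
      show ?case unfolding upset_ideal_def
      proof (intro CollectI ballI)
        fix m assume "m \<in> Poly_Mapping.keys (p \<otimes>\<^bsub>poly_ring V\<^esub> q)"
        then obtain x y where m: "m = x + y" "x \<in> Poly_Mapping.keys p" "y \<in> Poly_Mapping.keys q"
          using keys_mult[of p q] by (auto simp: poly_ring_simps)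
        then obtain a t b t' where "a \<in> A" "x = a + t" "b \<in> B" "y = b + t'"
            "Poly_Mapping.keys x \<subseteq> V" "Poly_Mapping.keys y \<subseteq> V"
          using prod unfolding upset_ideal_def by blast
        then show "Poly_Mapping.keys m \<subseteq> V \<and> (\<exists>c\<in>{a + b |a b. a \<in> A \<and> b \<in> B}. \<exists>t. m = c + t)"
          using m by (intro conjI bexI[of _ "a + b"] exI[of _ "t + t'"]) (auto simp: keys_add_nat ac_simps)
      qed
    next
      case (sum s1 s2)
      then show ?case by (intro additive_subgroup.a_closed[OF Q.is_additive_subgroup])
    qed
  qed
  show "?Q \<subseteq> ?P"
  proof (rule upset_ideal_least)
    show "ideal ?P (poly_ring V :: ('v, 'k) mpoly ring)"
      by (intro R.ideal_prod_is_ideal ideal_upset_ideal)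
    fix c assume "c \<in> {a + b |a b. a \<in> A \<and> b \<in> B}"
    then obtain a b where c: "c = a + b" "a \<in> A" "b \<in> B" by blast
    have "(mono_of a :: ('v, 'k) mpoly) \<otimes>\<^bsub>poly_ring V\<^esub> mono_of b \<in> ?P"
      using c assms by (intro ideal_prod.prod) (fastforce simp: mono_of_in_upset_ideal intro!: exI[of _ 0])+
    then show "(mono_of c :: ('v, 'k) mpoly) \<in> ?P"
      using c by (simp add: poly_ring_simps mono_of_def mult_single)
  qed
qed

lemma inj_mono_of: "mono_of a = (mono_of b :: ('v, 'k::field) mpoly) \<longleftrightarrow> a = b"
proof -
  have "Poly_Mapping.keys (mono_of a :: ('v, 'k) mpoly) = {a}" for a :: "'v \<Rightarrow>\<^sub>0 nat"
    by (simp add: mono_of_def)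
  then show ?thesis by (metis singleton_inject)
qed

text \<open>The definite description is met by \<open>A\<close> alone: if \<open>B\<close> also generates
  the ideal, then each \<open>a \<in> A\<close> is divisible by some \<open>b \<in> B\<close>,
  which is divisible by some \<open>a' \<in> A\<close>; as \<open>A\<close> is an antichain,
  \<open>a' = a\<close> and hence \<open>b = a\<close>. So \<open>A\<close> is contained in
  every monomial generating set, and irredundancy forces equality.\<close>
lemma min_mono_gens_antichain:
  assumes A: "\<And>a. a \<in> A \<Longrightarrow> Poly_Mapping.keys a \<subseteq> V"
    and anti: "\<And>a b t. a \<in> A \<Longrightarrow> b \<in> A \<Longrightarrow> b = a + t \<Longrightarrow> a = b"
  shows "min_mono_gens V (upset_ideal V A) = (mono_of ` A :: ('v, 'k::field) mpoly set)"
  unfolding min_mono_gens_def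
proof (rule the_equality)
  let ?J = "upset_ideal V A :: ('v, 'k) mpoly set"
  have mon: "\<exists>B. M = mono_of ` B \<and> (\<forall>b\<in>B. Poly_Mapping.keys b \<subseteq> V)"
    if "M \<subseteq> monomials V" for M :: "('v, 'k) mpoly set"
    using that by (intro exI[of _ "{b. Poly_Mapping.keys b \<subseteq> V \<and> mono_of b \<in> M}"])
      (auto simp: monomials_def image_def)
  have sup: "A \<subseteq> B" if B: "\<forall>b\<in>B. Poly_Mapping.keys b \<subseteq> V"
    and eq: "(Idl\<^bsub>poly_ring V\<^esub> (mono_of ` B) :: ('v, 'k) mpoly set) = ?J" for B
  proof
    fix a assume "a \<in> A"
    have eq': "(upset_ideal V B :: ('v, 'k) mpoly set) = ?J" using eq genideal_monomials[of B V] B by auto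
    have "(mono_of a :: ('v, 'k) mpoly) \<in> ?J"
      using A \<open>a \<in> A\<close> by (fastforce simp: mono_of_in_upset_ideal intro!: exI[of _ 0])+
    then obtain b t where b: "b \<in> B" "a = b + t" unfolding eq'[symmetric] mono_of_in_upset_ideal by blast
    have "(mono_of b :: ('v, 'k) mpoly) \<in> ?J"
      unfolding eq'[symmetric] using B b by (fastforce simp: mono_of_in_upset_ideal intro!: exI[of _ 0])+
    then obtain a' t' where a': "a' \<in> A" "b = a' + t'" unfolding mono_of_in_upset_ideal by blast
    have "a' = a" using anti[OF a'(1) \<open>a \<in> A\<close>, of "t' + t"] b a' by (simp add: ac_simps)
    then have "t' + t = 0" using b a' by (simp add: add.assoc)
    then have "t = 0"
      by (intro poly_mapping_eqI) (metis add_is_0 lookup_add lookup_zero)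
    then show "a \<in> B" using b by simp
  qed
  show "mono_of ` A \<subseteq> (monomials V :: ('v, 'k) mpoly set) \<and> Idl\<^bsub>poly_ring V\<^esub> (mono_of ` A) = ?J \<and>
     (\<forall>M'. M' \<subset> mono_of ` A \<longrightarrow> Idl\<^bsub>poly_ring V\<^esub> M' \<noteq> ?J)"
  proof (intro conjI allI impI notI)
    show sub: "mono_of ` A \<subseteq> (monomials V :: ('v, 'k) mpoly set)" using A by (auto simp: monomials_def)
    show "Idl\<^bsub>poly_ring V\<^esub> (mono_of ` A) = ?J" by (rule genideal_monomials[OF A])
    fix M' :: "('v, 'k) mpoly set" assume M': "M' \<subset> mono_of ` A" "Idl\<^bsub>poly_ring V\<^esub> M' = ?J"
    have "M' \<subseteq> monomials V" using M'(1) sub by (meson psubset_imp_subset subset_trans)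
    from mon[OF this] obtain B where B: "M' = mono_of ` B" "\<forall>b\<in>B. Poly_Mapping.keys b \<subseteq> V" by blast
    have "A \<subseteq> B" using sup[OF B(2)] M'(2) B(1) by simp
    then show False using M'(1) B(1) by (simp add: image_mono less_le_not_le)
  qed
  fix M :: "('v, 'k) mpoly set"
  assume M: "M \<subseteq> monomials V \<and> Idl\<^bsub>poly_ring V\<^esub> M = ?J \<and> (\<forall>M'. M' \<subset> M \<longrightarrow> Idl\<^bsub>poly_ring V\<^esub> M' \<noteq> ?J)"
  obtain B where B: "M = mono_of ` B" "\<forall>b\<in>B. Poly_Mapping.keys b \<subseteq> V" using mon[of M] M by blast
  have "A \<subseteq> B" using sup[OF B(2)] M B(1) by simp
  then have "mono_of ` A \<subseteq> M" using B(1) by (simp add: image_mono)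
  moreover have "Idl\<^bsub>poly_ring V\<^esub> (mono_of ` A) = ?J" by (rule genideal_monomials[OF A])
  ultimately show "M = mono_of ` A" using M by (metis psubsetI)
qed

section \<open>Minimal generators and maximum matchings\<close>

text \<open>A product of edge generators is represented by the multiset \<open>M\<close> of the edges
  used, and \<open>mdeg M v\<close> is the exponent of the variable \<open>v\<close> in it.\<close>
definition mdeg :: "'v set multiset \<Rightarrow> 'v \<Rightarrow> nat" where
  "mdeg M v = size {#e \<in># M. v \<in> e#}"

definition exponents :: "'v set multiset \<Rightarrow> ('v \<Rightarrow>\<^sub>0 nat)" where
  "exponents M = (\<Sum>e\<in>#M. \<Sum>v\<in>e. Poly_Mapping.single v 1)"

text \<open>The multisets of edges whose monomial respects the bound \<open>c\<close> are known in
  combinatorial optimization as \<open>c\<close>-matchings (or \<open>b\<close>-matchings).\<close>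
definition b_matching :: "'v ugraph \<Rightarrow> ('v \<Rightarrow> nat) \<Rightarrow> 'v set multiset \<Rightarrow> bool" where
  "b_matching G c M \<longleftrightarrow> set_mset M \<subseteq> edges G \<and> (\<forall>v\<in>verts G. mdeg M v \<le> c v)"

definition max_b_matching :: "'v ugraph \<Rightarrow> ('v \<Rightarrow> nat) \<Rightarrow> 'v set multiset \<Rightarrow> bool" where
  "max_b_matching G c M \<longleftrightarrow>
     b_matching G c M \<and> (\<forall>M'. b_matching G c M' \<longrightarrow> size M' \<le> size M)"

lemma mdeg_empty [simp]: "mdeg {#} v = 0"
  by (simp add: mdeg_def)

lemma mdeg_add_mset [simp]: "mdeg (add_mset e M) v = (if v \<in> e then Suc (mdeg M v) else mdeg M v)"
  by (simp add: mdeg_def)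

lemma mdeg_union [simp]: "mdeg (M + N) v = mdeg M v + mdeg N v"
  by (simp add: mdeg_def)

lemma mdeg_replicate [simp]: "mdeg (replicate_mset n e) v = (if v \<in> e then n else 0)"
  by (induction n) auto

text \<open>Double counting of incidences. It turns the total degree on a vertex cover, or on one side of
  a tree, into a sum over the edges of \<open>M\<close>, which can be compared edge by edge.\<close>
lemma sum_mdeg:
  assumes "finite S"
  shows "(\<Sum>v\<in>S. mdeg M v) = (\<Sum>e\<in>#M. card (e \<inter> S))"
proof (induction M)
  case (add e M)
  have "(\<Sum>v\<in>S. mdeg (add_mset e M) v) = (\<Sum>v\<in>S. mdeg M v + (if v \<in> e then 1 else 0))"
    by (intro sum.cong) auto
  also have "\<dots> = (\<Sum>v\<in>S. mdeg M v) + card (e \<inter> S)"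
    using assms by (simp add: sum.distrib sum.If_cases Int_commute)
  finally show ?case using add by simp
qed simp

text \<open>Weak duality: every edge of the matching takes at least one unit of capacity from the cover.\<close>
lemma size_le_cover:
  assumes "finite C" "C \<subseteq> verts G" "\<And>e. e \<in> edges G \<Longrightarrow> e \<inter> C \<noteq> {}" "b_matching G c M"
  shows "size M \<le> (\<Sum>v\<in>C. c v)"
proof -
  have "size M = (\<Sum>e\<in>#M. 1)" by simp
  also have "\<dots> \<le> (\<Sum>e\<in>#M. card (e \<inter> C))"
    using assms by (intro sum_mset_mono) (auto simp: b_matching_def Suc_le_eq card_gt_0_iff)
  also have "\<dots> = (\<Sum>v\<in>C. mdeg M v)" using assms(1) by (simp add: sum_mdeg)
  also have "\<dots> \<le> (\<Sum>v\<in>C. c v)" using assms by (intro sum_mono) (auto simp: b_matching_def)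
  finally show ?thesis .
qed

text \<open>Complementary slackness: if a vertex cover attains the bound above, then the matching
  saturates the cover and uses no edge with both ends in it. Since this applies to all maximum
  matchings at once, one tight cover fixes many degrees simultaneously.\<close>
lemma cover_tight:
  assumes C: "finite C" "C \<subseteq> verts G" "\<And>e. e \<in> edges G \<Longrightarrow> e \<inter> C \<noteq> {}" and M: "b_matching G c M"
    and eq: "size M = (\<Sum>v\<in>C. c v)"
  shows "\<And>v. v \<in> C \<Longrightarrow> mdeg M v = c v" "\<And>e. e \<in># M \<Longrightarrow> card (e \<inter> C) = 1"
proof -
  have pos: "1 \<le> card (e \<inter> C)" if "e \<in># M" for e
    using that C M by (auto simp: b_matching_def Suc_le_eq card_gt_0_iff)
  have le: "mdeg M v \<le> c v" if "v \<in> C" for v using that C M by (auto simp: b_matching_def)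
  have le1: "size M \<le> (\<Sum>e\<in>#M. card (e \<inter> C))"
    using sum_mset_mono[of M "\<lambda>_. 1" "\<lambda>e. card (e \<inter> C)"] pos by simp
  show "mdeg M v = c v" if "v \<in> C" for v
  proof (rule ccontr)
    assume "mdeg M v \<noteq> c v"
    then have "(\<Sum>v\<in>C. mdeg M v) < (\<Sum>v\<in>C. c v)"
      using that le C(1) le_neq_implies_less[OF le[OF that]] by (intro sum_strict_mono_ex1) auto
    then show False using le1 eq sum_mdeg[OF C(1), of M] by simp
  qed
  show "card (e \<inter> C) = 1" if "e \<in># M" for e
  proof (rule ccontr)
    assume "card (e \<inter> C) \<noteq> 1"
    then have 2: "2 \<le> card (e \<inter> C)" using pos[OF that] by simp
    obtain N where N: "M = add_mset e N" using multi_member_split[OF \<open>e \<in># M\<close>] by blast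
    have "size N \<le> (\<Sum>e\<in>#N. card (e \<inter> C))"
      using sum_mset_mono[of N "\<lambda>_. 1" "\<lambda>e. card (e \<inter> C)"] pos N by simp
    then have "size M < (\<Sum>e\<in>#M. card (e \<inter> C))" using 2 N by simp
    moreover have "(\<Sum>v\<in>C. mdeg M v) \<le> (\<Sum>v\<in>C. c v)" using le by (intro sum_mono) auto
    ultimately show False using eq sum_mdeg[OF C(1), of M] by simp
  qed
qed

lemma card_edge_cover:
  "simple_graph G \<Longrightarrow> e \<in> edges G \<Longrightarrow> card (e \<inter> verts G) = 2"
  unfolding simple_graph_def by (metis inf.absorb1)

lemma lookup_exponents:
  assumes "simple_graph G" "set_mset M \<subseteq> edges G"
  shows "Poly_Mapping.lookup (exponents M) v = mdeg M v"
  using assms(2)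
proof (induction M)
  case (add e M)
  have fin: "finite e" using assms(1) add.prems by (intro card_ge_0_finite) (auto simp: simple_graph_def)
  then have "Poly_Mapping.lookup (\<Sum>v\<in>e. Poly_Mapping.single v (1::nat)) v = (if v \<in> e then 1 else 0)"
    by (simp add: lookup_sum lookup_single when_def)
  then show ?case using add by (simp add: exponents_def lookup_add)
qed (simp add: exponents_def)

lemma mdeg_outside:
  "simple_graph G \<Longrightarrow> set_mset M \<subseteq> edges G \<Longrightarrow> v \<notin> verts G \<Longrightarrow> mdeg M v = 0"
  unfolding mdeg_def simple_graph_def by (auto simp: filter_mset_eq_conv)

lemma keys_exponents:
  assumes "simple_graph G" "set_mset M \<subseteq> edges G"
  shows "Poly_Mapping.keys (exponents M) \<subseteq> verts G"
proof
  fix v assume "v \<in> Poly_Mapping.keys (exponents M)"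
  then have "mdeg M v \<noteq> 0" by (simp add: in_keys_iff lookup_exponents[OF assms])
  then show "v \<in> verts G" by (metis mdeg_outside[OF assms])
qed

lemma sum_mdeg_verts:
  assumes "simple_graph G" "set_mset M \<subseteq> edges G"
  shows "(\<Sum>v\<in>verts G. mdeg M v) = 2 * size M"
proof -
  have "(\<Sum>e\<in>#M. card (e \<inter> verts G)) = (\<Sum>e\<in>#M. 2)"
    using assms card_edge_cover by (intro arg_cong[where f = sum_mset] image_mset_cong) auto
  then show ?thesis using assms(1) by (simp add: sum_mdeg simple_graph_def)
qed

lemma upset_ideal_zero: "upset_ideal V {0} = carrier (poly_ring V)"
  by (simp add: upset_ideal_def poly_ring_simps)

lemma edge_ideal_eq:
  assumes "simple_graph G"
  shows "edge_ideal G = (upset_ideal (verts G) {exponents M |M. set_mset M \<subseteq> edges G \<and> size M = 1} :: ('v, 'k::field) mpoly set)"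
proof -
  let ?A = "{exponents M |M. set_mset M \<subseteq> edges G \<and> size M = 1}"
  have single: "set_mset M \<subseteq> edges G \<and> size M = 1 \<longleftrightarrow> (\<exists>e\<in>edges G. M = {#e#})" for M
    using size_1_singleton_mset[of M] by auto
  have 1: "?A = {exponents {#e#} | e. e \<in> edges G}" unfolding single by blast
  have 2: "?A = {Poly_Mapping.single u 1 + Poly_Mapping.single v 1 | u v. {u, v} \<in> edges G}"
    unfolding 1
  proof (intro Set.set_eqI iffI)
    fix x assume "x \<in> {exponents {#e#} |e. e \<in> edges G}"
    then obtain e where e: "x = exponents {#e#}" "e \<in> edges G" by blast
    then obtain u v where "e = {u, v}" "u \<noteq> v" using assms by (auto simp: simple_graph_def card_2_iff)
    then show "x \<in> {Poly_Mapping.single u 1 + Poly_Mapping.single v 1 | u v. {u, v} \<in> edges G}"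
      using e by (auto simp: exponents_def)
  next
    fix x assume "x \<in> {Poly_Mapping.single u 1 + Poly_Mapping.single v (1::nat) | u v. {u, v} \<in> edges G}"
    then obtain u v where e: "x = Poly_Mapping.single u 1 + Poly_Mapping.single v 1" "{u, v} \<in> edges G" by blast
    moreover have "u \<noteq> v" using assms e by (auto simp: simple_graph_def)
    ultimately show "x \<in> {exponents {#e#} |e. e \<in> edges G}"
      by (auto simp: exponents_def intro!: exI[of _ "{u, v}"])
  qed
  have "{mono_of (Poly_Mapping.single u 1 + Poly_Mapping.single v 1) | u v. {u, v} \<in> edges G} =
    (mono_of ` ?A :: ('v, 'k::field) mpoly set)"
    unfolding 2 by blast
  moreover have "Poly_Mapping.keys a \<subseteq> verts G" if "a \<in> ?A" for a using that keys_exponents[OF assms] by blast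
  ultimately show ?thesis unfolding edge_ideal_def by (simp only: genideal_monomials)
qed

lemma ideal_pow_edge_ideal:
  assumes "simple_graph G"
  shows "ideal_pow (verts G) (edge_ideal G :: ('v, 'k::field) mpoly set) q
    = upset_ideal (verts G) {exponents M |M. set_mset M \<subseteq> edges G \<and> size M = q}"
proof (induction q)
  case 0
  have "{exponents M |M. set_mset M \<subseteq> edges G \<and> size M = 0} = {0}" by (auto simp: exponents_def)
  then show ?case by (simp add: ideal_pow_def nat_pow_def ideals_set_def upset_ideal_zero)
next
  case (Suc q)
  let ?A = "\<lambda>q. {exponents M |M. set_mset M \<subseteq> edges G \<and> size M = q}"
  have keys: "Poly_Mapping.keys a \<subseteq> verts G" if "a \<in> ?A r" for a r using that keys_exponents[OF assms] by blast
  have add: "{a + b |a b. a \<in> ?A q \<and> b \<in> ?A 1} = ?A (Suc q)" (is "?L = ?R")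
  proof (intro Set.set_eqI iffI)
    fix x assume "x \<in> ?L"
    then obtain M N where "x = exponents M + exponents N" "set_mset M \<subseteq> edges G" "set_mset N \<subseteq> edges G"
       "size M = q" "size N = 1" by blast
    then show "x \<in> ?R" by (auto simp: exponents_def intro!: exI[of _ "M + N"])
  next
    fix x assume "x \<in> ?R"
    then obtain M where M: "x = exponents M" "set_mset M \<subseteq> edges G" "size M = Suc q" by blast
    then obtain e N where N: "M = add_mset e N" "size N = q" by (metis size_Suc_Diff1 size_eq_Suc_imp_eq_union Suc_inject size_add_mset)
    have "x = exponents N + exponents {#e#}" using M N by (simp add: exponents_def add.commute)
    moreover have "exponents N \<in> ?A q" "exponents {#e#} \<in> ?A 1" using M N by force+
    ultimately show "x \<in> ?L" by blast
  qed
  have "ideal_pow (verts G) (edge_ideal G :: ('v, 'k::field) mpoly set) (Suc q) =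
     ideal_pow (verts G) (edge_ideal G) q \<cdot>\<^bsub>poly_ring (verts G)\<^esub> edge_ideal G"
    by (simp add: ideal_pow_def nat_pow_def ideals_set_def)
  also have "\<dots> = upset_ideal (verts G) (?A (Suc q))"
    unfolding Suc unfolding edge_ideal_eq[OF assms] add[symmetric] by (rule ideal_prod_upset_ideal) (use keys in blast)+
  finally show ?case .
qed

text \<open>A divisor of a monomial within the bound is itself within the bound, so it is enough to keep
  the generators that respect \<open>c\<close>.\<close>
lemma bounded_ideal_upset_ideal:
  assumes "\<And>a. a \<in> A \<Longrightarrow> Poly_Mapping.keys a \<subseteq> V"
  shows "bounded_ideal V c (upset_ideal V A :: ('v, 'k::field) mpoly set)
    = upset_ideal V {a \<in> A. \<forall>v\<in>V. Poly_Mapping.lookup a v \<le> c v}"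
proof -
  let ?B = "{b. Poly_Mapping.keys b \<subseteq> V \<and> (\<exists>a\<in>A. \<exists>t. b = a + t) \<and> (\<forall>v\<in>V. Poly_Mapping.lookup b v \<le> c v)}"
  have "bounded_ideal V c (upset_ideal V A :: ('v, 'k::field) mpoly set) = Idl\<^bsub>poly_ring V\<^esub> (mono_of ` ?B)"
    unfolding bounded_ideal_def mono_of_in_upset_ideal by (intro arg_cong[where f = "genideal _"]) blast
  also have "\<dots> = upset_ideal V ?B" by (rule genideal_monomials) blast
  also have "\<dots> = upset_ideal V {a \<in> A. \<forall>v\<in>V. Poly_Mapping.lookup a v \<le> c v}"
  proof -
    have "(\<exists>b\<in>?B. \<exists>t. m = b + t) \<longleftrightarrow> (\<exists>a\<in>{a \<in> A. \<forall>v\<in>V. Poly_Mapping.lookup a v \<le> c v}. \<exists>t. m = a + t)"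
      (is "?l = ?r") for m
    proof
      assume ?l
      then obtain a t t' where "a \<in> A" "m = a + t + t'" "\<forall>v\<in>V. Poly_Mapping.lookup (a + t) v \<le> c v" by blast
      then show ?r by (intro bexI[of _ a] exI[of _ "t + t'"]) (auto simp: lookup_add add.assoc intro: add_leD1)
    next
      assume ?r
      then obtain a t where "a \<in> A" "m = a + t" "\<forall>v\<in>V. Poly_Mapping.lookup a v \<le> c v" by blast
      then have "a \<in> ?B" "m = a + t" using assms[of a] add_0_right[of a, symmetric] by blast+
      then show ?l by blast
    qed
    then show ?thesis unfolding upset_ideal_def by simp
  qed
  finally show ?thesis .
qed

lemma upset_ideal_nonzero:
  assumes "\<And>a. a \<in> A \<Longrightarrow> Poly_Mapping.keys a \<subseteq> V"
  shows "(upset_ideal V A :: ('v, 'k::field) mpoly set) \<noteq> {0} \<longleftrightarrow> A \<noteq> {}"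
proof
  assume "A \<noteq> {}"
  then obtain a where "a \<in> A" by blast
  then have "(mono_of a :: ('v, 'k) mpoly) \<in> upset_ideal V A"
    using assms by (fastforce simp: mono_of_in_upset_ideal intro!: exI[of _ 0])
  moreover have "mono_of a \<noteq> (0 :: ('v, 'k) mpoly)" unfolding mono_of_def
    by (metis keys_single keys_zero one_neq_zero insert_not_empty)
  ultimately show "(upset_ideal V A :: ('v, 'k::field) mpoly set) \<noteq> {0}" by blast
next
  have "(upset_ideal V {} :: ('v, 'k) mpoly set) = {0}" by (auto simp: upset_ideal_def)
  then show "(upset_ideal V A :: ('v, 'k) mpoly set) \<noteq> {0} \<Longrightarrow> A \<noteq> {}" by blast
qed

lemma bounded_ideal_edge_ideal_pow:
  assumes "simple_graph G"
  shows "bounded_ideal (verts G) c (ideal_pow (verts G) (edge_ideal G :: ('v, 'k::field) mpoly set) q)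
    = upset_ideal (verts G) (exponents ` {M. b_matching G c M \<and> size M = q})"
proof -
  have "exponents ` {M. b_matching G c M \<and> size M = q} = {a \<in> {exponents M |M. set_mset M \<subseteq> edges G \<and> size M = q}.
      \<forall>v\<in>verts G. Poly_Mapping.lookup a v \<le> c v}"
    using lookup_exponents[OF assms] by (auto simp: b_matching_def)
  then show ?thesis
    unfolding ideal_pow_edge_ideal[OF assms]
    by (subst bounded_ideal_upset_ideal) (use keys_exponents[OF assms] in blast, simp)
qed

lemma edge_meets_verts: "simple_graph G \<Longrightarrow> e \<in> edges G \<Longrightarrow> e \<inter> verts G \<noteq> {}"
  using card_edge_cover by fastforce

lemma max_b_matching_exists:
  assumes "simple_graph G"
  obtains M where "max_b_matching G c M"
proof -
  have "size M \<le> (\<Sum>v\<in>verts G. c v)" if "b_matching G c M" for M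
    by (rule size_le_cover[OF _ subset_refl edge_meets_verts[OF assms] that])
      (use assms in \<open>simp add: simple_graph_def\<close>)
  moreover have "b_matching G c {#}" by (simp add: b_matching_def)
  ultimately obtain M where "b_matching G c M" "\<forall>M'. b_matching G c M' \<longrightarrow> size M' \<le> size M"
    using ex_has_greatest_nat[of "b_matching G c" "{#}" size "Suc (\<Sum>v\<in>verts G. c v)"]
    by (auto simp: less_Suc_eq_le)
  then show ?thesis using that by (auto simp: max_b_matching_def)
qed

lemma max_b_matching_size_eq:
  "max_b_matching G c M \<Longrightarrow> max_b_matching G c M' \<longleftrightarrow> b_matching G c M' \<and> size M' = size M"
  unfolding max_b_matching_def by (metis order_antisym)

lemma delta_edge_ideal:
  assumes "simple_graph G" "max_b_matching G c M"
  shows "delta (verts G) c (edge_ideal G :: ('v, 'k::field) mpoly set) = size M"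
proof -
  have "bounded_ideal (verts G) c (ideal_pow (verts G) (edge_ideal G :: ('v, 'k::field) mpoly set) q) \<noteq> {0}
     \<longleftrightarrow> (\<exists>M. b_matching G c M \<and> size M = q)" for q
    unfolding bounded_ideal_edge_ideal_pow[OF assms(1)]
    using keys_exponents[OF assms(1)] by (subst upset_ideal_nonzero) (auto simp: b_matching_def)
  then show ?thesis unfolding delta_def using assms(2)
    by (intro Greatest_equality) (auto simp: max_b_matching_def)
qed

text \<open>All exponent vectors of maximum matchings have the same total degree, namely twice the size of
  the matching, and therefore none of them properly divides another one.\<close>
lemma W_gens_eq:
  assumes "simple_graph G"
  shows "W_gens c G = (mono_of ` exponents ` {M. max_b_matching G c M} :: ('v, 'k::field) mpoly set)"
proof -
  obtain M where M: "max_b_matching G c M" by (rule max_b_matching_exists[OF assms])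
  have eq: "{N. b_matching G c N \<and> size N = size M} = {N. max_b_matching G c N}"
    using max_b_matching_size_eq[OF M] by blast
  have "W_gens c G = (min_mono_gens (verts G) (upset_ideal (verts G) (exponents ` {N. max_b_matching G c N})) :: ('v, 'k) mpoly set)"
    unfolding W_gens_def Let_def delta_edge_ideal[OF assms M] bounded_ideal_edge_ideal_pow[OF assms] eq ..
  also have "\<dots> = mono_of ` exponents ` {N. max_b_matching G c N}"
  proof (rule min_mono_gens_antichain)
    show "Poly_Mapping.keys a \<subseteq> verts G" if "a \<in> exponents ` {N. max_b_matching G c N}" for a
      using that keys_exponents[OF assms] by (auto simp: max_b_matching_def b_matching_def)
    fix a b t assume "a \<in> exponents ` {N. max_b_matching G c N}" "b \<in> exponents ` {N. max_b_matching G c N}" and b: "b = a + t"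
    then obtain A B where AB: "a = exponents A" "b = exponents B" "max_b_matching G c A" "max_b_matching G c B" by blast
    then have ed: "set_mset A \<subseteq> edges G" "set_mset B \<subseteq> edges G" and sz: "size A = size B"
      using max_b_matching_size_eq[of G c A B] by (auto simp: max_b_matching_def b_matching_def)
    have deg: "mdeg B v = mdeg A v + Poly_Mapping.lookup t v" for v
      using AB b lookup_exponents[OF assms ed(1)] lookup_exponents[OF assms ed(2)] by (metis lookup_add)
    then have "2 * size B = 2 * size A + (\<Sum>v\<in>verts G. Poly_Mapping.lookup t v)"
      using sum_mdeg_verts[OF assms ed(1)] sum_mdeg_verts[OF assms ed(2)] by (simp add: sum.distrib)
    then have "\<forall>v\<in>verts G. Poly_Mapping.lookup t v = 0"
      using sz assms by (simp add: simple_graph_def)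
    moreover have "Poly_Mapping.lookup t v = 0" if "v \<notin> verts G" for v
      using deg[of v] mdeg_outside[OF assms ed(2) that] by simp
    ultimately have "t = 0" by (intro poly_mapping_eqI) auto
    then show "a = b" using b by simp
  qed
  finally show ?thesis .
qed

text \<open>The strong exchange property in terms of matchings. The degree condition on \<open>N\<close>
  is written with sums on both sides to avoid truncated subtraction.\<close>
definition exchange_property :: "'v ugraph \<Rightarrow> ('v \<Rightarrow> nat) \<Rightarrow> bool" where
  "exchange_property G c \<longleftrightarrow> (\<forall>M M' \<xi> \<rho>. max_b_matching G c M \<longrightarrow> max_b_matching G c M' \<longrightarrow>
     mdeg M' \<xi> < mdeg M \<xi> \<longrightarrow> mdeg M \<rho> < mdeg M' \<rho> \<longrightarrow>
     (\<exists>N. max_b_matching G c N \<and>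
        (\<forall>v. mdeg N v + (if v = \<xi> then 1 else 0) = mdeg M v + (if v = \<rho> then 1 else 0))))"

lemma strong_exchange_W_gens:
  assumes "simple_graph G"
  shows "strong_exchange (W_gens c G :: ('v, 'k::field) mpoly set) \<longleftrightarrow> exchange_property G c"
proof -
  have ed: "set_mset M \<subseteq> edges G" if "max_b_matching G c M" for M
    using that by (auto simp: max_b_matching_def b_matching_def)
  have mem: "(mono_of a :: ('v, 'k) mpoly) \<in> W_gens c G \<longleftrightarrow> (\<exists>M. max_b_matching G c M \<and> a = exponents M)" for a
    unfolding W_gens_eq[OF assms] by (auto simp: inj_mono_of)
  have eq: "Poly_Mapping.single \<rho> 1 + (exponents M - Poly_Mapping.single \<xi> 1) = exponents N \<longleftrightarrow>
      (\<forall>v. mdeg N v + (if v = \<xi> then 1 else 0) = mdeg M v + (if v = \<rho> then 1 else 0))"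
    if "max_b_matching G c M" "max_b_matching G c N" "mdeg M \<xi> > 0" for M N \<xi> \<rho>
  proof -
    have "Poly_Mapping.single \<rho> 1 + (exponents M - Poly_Mapping.single \<xi> 1) = exponents N \<longleftrightarrow>
       (\<forall>v. (if \<rho> = v then 1 else 0) + (mdeg M v - (if \<xi> = v then 1 else 0)) = mdeg N v)"
      unfolding poly_mapping_eq_iff fun_eq_iff
      by (simp add: lookup_add lookup_minus lookup_single when_def lookup_exponents[OF assms ed] that)
    also have "\<dots> \<longleftrightarrow> (\<forall>v. mdeg N v + (if v = \<xi> then 1 else 0) = mdeg M v + (if v = \<rho> then 1 else 0))"
      using that(3) by (intro all_cong1) auto
    finally show ?thesis .
  qed
  show ?thesis
    unfolding strong_exchange_def exchange_property_def mem
  proof (intro iffI allI impI, goal_cases)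
    case (1 M M' \<xi> \<rho>)
    have "\<exists>N. max_b_matching G c N \<and> Poly_Mapping.single \<rho> 1 + (exponents M - Poly_Mapping.single \<xi> 1) = exponents N"
      by (rule 1(1)[rule_format, of "exponents M" "exponents M'"])
        (use 1(2-5) in \<open>auto simp: lookup_exponents[OF assms ed]\<close>)
    moreover have "mdeg M \<xi> > 0" using 1(4) by simp
    ultimately show ?case using eq[OF 1(2)] by blast
  next
    case (2 a b \<xi> \<rho>)
    then obtain M M' where M: "max_b_matching G c M" "a = exponents M" "max_b_matching G c M'" "b = exponents M'" by blast
    have d: "mdeg M' \<xi> < mdeg M \<xi>" "mdeg M \<rho> < mdeg M' \<rho>"
      using 2(4,5) M by (simp_all add: lookup_exponents[OF assms ed])
    obtain N where N: "max_b_matching G c N"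
        "\<forall>v. mdeg N v + (if v = \<xi> then 1 else 0) = mdeg M v + (if v = \<rho> then 1 else 0)"
      using 2(1)[rule_format, OF M(1,3) d] by blast
    have "mdeg M \<xi> > 0" using d by simp
    then show ?case using eq[OF M(1) N(1)] N M(2) by blast
  qed
qed

lemma strong_exchange_graph_iff:
  "simple_graph G \<Longrightarrow> strong_exchange_graph TYPE('k::field) G \<longleftrightarrow>
     (\<forall>c. (\<forall>v\<in>verts G. c v > 0) \<longrightarrow> exchange_property G c)"
  unfolding strong_exchange_graph_def by (simp add: strong_exchange_W_gens)

section \<open>Trees and the obstruction to the exchange property\<close>

lemma edge_facts:
  assumes "simple_graph G" "{x, y} \<in> edges G"
  shows "x \<noteq> y" "x \<in> verts G" "y \<in> verts G" "{y, x} \<in> edges G"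
proof -
  have "{x, y} \<subseteq> verts G" "card {x, y} = 2" using assms unfolding simple_graph_def by blast+
  then show "x \<noteq> y" "x \<in> verts G" "y \<in> verts G" by auto
  show "{y, x} \<in> edges G" using assms(2) by (simp add: insert_commute)
qed

lemma edgeE:
  assumes "simple_graph G" "e \<in> edges G"
  obtains x y where "e = {x, y}" "x \<noteq> y" "{x, y} \<in> edges G"
  using assms unfolding simple_graph_def card_2_iff by metis

lemma tree_simple: "tree G \<Longrightarrow> simple_graph G"
  by (simp add: tree_def)

text \<open>Cutting a walk short at the first return to a vertex already visited leaves a path.\<close>
lemma rtrancl_path:
  assumes "(x, y) \<in> R\<^sup>*"
  obtains p where "p \<noteq> []" "hd p = x" "last p = y" "distinct p"
    "\<And>i. Suc i < length p \<Longrightarrow> (p ! i, p ! Suc i) \<in> R"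
  using assms
proof (induction arbitrary: thesis rule: rtrancl_induct)
  case base
  show ?case by (rule base[of "[x]"]) auto
next
  case (step y z)
  obtain p where p: "p \<noteq> []" "hd p = x" "last p = y" "distinct p"
    "\<And>i. Suc i < length p \<Longrightarrow> (p ! i, p ! Suc i) \<in> R" by (rule step.IH) blast
  show ?case
  proof (cases "z \<in> set p")
    case True
    then obtain i where i: "i < length p" "p ! i = z" by (auto simp: in_set_conv_nth)
    have "last (take (Suc i) p) = z" using i by (simp add: take_Suc_conv_app_nth)
    then show ?thesis using p i by (intro step.prems[of "take (Suc i) p"]) (auto simp: hd_conv_nth)
  next
    case False
    have "(p ! i, (p @ [z]) ! Suc i) \<in> R" if "Suc i < length (p @ [z])" "i < length p" for i
    proof (cases "Suc i < length p")
      case False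
      then have "i = length p - 1" using that by simp
      then have "p ! i = y" using p by (simp add: last_conv_nth)
      then show ?thesis using step.hyps(2) False that by (simp add: nth_append)
    qed (use p in \<open>simp add: nth_append\<close>)
    then show ?thesis using p False
      by (intro step.prems[of "p @ [z]"]) (auto simp: nth_append)
  qed
qed

lemma tree_no_triangle:
  assumes "tree G" "{a, b} \<in> edges G" "{b, c} \<in> edges G" shows "{c, a} \<notin> edges G"
proof
  assume "{c, a} \<in> edges G"
  note ed = edge_facts[OF tree_simple[OF assms(1)]]
  have "{[a, b, c] ! i, [a, b, c] ! (Suc i mod 3)} \<in> edges G" if "i < 3" for i
  proof -
    consider "i = 0" | "i = 1" | "i = 2" using \<open>i < 3\<close> by linarith
    then show ?thesis using assms \<open>{c, a} \<in> edges G\<close> by cases simp_all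
  qed
  moreover have "distinct [a, b, c]" "set [a, b, c] \<subseteq> verts G"
    using ed(1,2)[OF assms(2)] ed(1,2)[OF assms(3)] ed(1,2)[OF \<open>{c, a} \<in> edges G\<close>] by simp_all
  ultimately have "is_cycle G [a, b, c]" by (simp add: is_cycle_def)
  then show False using assms(1) by (auto simp: tree_def)
qed

text \<open>The vertices that \<open>y\<close> can reach without passing through \<open>u\<close>. For a
  neighbour \<open>y\<close> of \<open>u\<close> in a tree this is the component of
  \<open>y\<close> after removal of the edge \<open>{u, y}\<close>.\<close>
definition branch :: "'v ugraph \<Rightarrow> 'v \<Rightarrow> 'v \<Rightarrow> 'v set" where
  "branch G u y = {x. (y, x) \<in> {(p, q). {p, q} \<in> edges G \<and> p \<noteq> u \<and> q \<noteq> u}\<^sup>*}"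

lemma branch_self: "y \<in> branch G u y"
  by (simp add: branch_def)

lemma branch_step:
  "x \<in> branch G u y \<Longrightarrow> x \<noteq> u \<Longrightarrow> {x, w} \<in> edges G \<Longrightarrow> w \<noteq> u \<Longrightarrow> w \<in> branch G u y"
  unfolding branch_def by (auto intro: rtrancl_into_rtrancl)

lemma branch_avoids: "y \<noteq> u \<Longrightarrow> u \<notin> branch G u y"
  unfolding branch_def by (auto elim: rtranclE)

text \<open>A path from \<open>y\<close> to \<open>z\<close> that avoids \<open>u\<close> would close up
  to a cycle through \<open>u\<close>.\<close>
lemma tree_branch_neighbour:
  assumes "tree G" "{u, y} \<in> edges G" "{u, z} \<in> edges G" "z \<in> branch G u y"
  shows "z = y"
proof (rule ccontr)
  assume "z \<noteq> y"
  note ed = edge_facts[OF tree_simple[OF assms(1)]]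
  obtain p where p: "p \<noteq> []" "hd p = y" "last p = z" "distinct p"
    "\<And>i. Suc i < length p \<Longrightarrow> (p ! i, p ! Suc i) \<in> {(p, q). {p, q} \<in> edges G \<and> p \<noteq> u \<and> q \<noteq> u}"
    using assms(4) unfolding branch_def by (auto elim: rtrancl_path)
  have len: "2 \<le> length p" using p(1-3) \<open>z \<noteq> y\<close> by (cases p; cases "tl p") auto
  have elem: "p ! i \<in> verts G \<and> p ! i \<noteq> u" if "i < length p" for i
  proof (cases "Suc i < length p")
    case True then show ?thesis using p(5)[of i] ed(2) by auto
  next
    case False
    then have "i = Suc (i - 1)" "Suc (i - 1) < length p" using that len by auto
    then show ?thesis using p(5)[of "i - 1"] ed(3) by auto
  qed
  have "is_cycle G (u # p)"
    unfolding is_cycle_def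
  proof (intro conjI allI impI)
    show "3 \<le> length (u # p)" "distinct (u # p)" using len elem p(4) by (auto simp: in_set_conv_nth)
    show "set (u # p) \<subseteq> verts G" using elem ed(2)[OF assms(2)] by (auto simp: in_set_conv_nth)
    fix i assume i: "i < length (u # p)"
    consider "i = 0" | j where "i = Suc j" "Suc j < length p" | "i = length p"
      using i by (cases i) (auto simp: less_Suc_eq)
    then show "{(u # p) ! i, (u # p) ! (Suc i mod length (u # p))} \<in> edges G"
    proof cases
      case 1 then show ?thesis using p(1,2) assms(2) by (simp add: hd_conv_nth)
    next
      case 2 then show ?thesis using p(5)[of j] by auto
    next
      case 3
      then have "(u # p) ! i = z" using p(1,3) len by (simp add: last_conv_nth nth_Cons')
      then show ?thesis using 3 ed(4)[OF assms(3)] by simp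
    qed
  qed
  then show False using assms(1) by (auto simp: tree_def)
qed

definition independent :: "'v ugraph \<Rightarrow> 'v set \<Rightarrow> bool" where
  "independent G I \<longleftrightarrow> (\<forall>x\<in>I. \<forall>y\<in>I. {x, y} \<notin> edges G)"

lemma maximal_independent_extension:
  assumes "finite (verts G)" "I0 \<subseteq> verts G" "independent G I0" "simple_graph G"
  obtains I where "I0 \<subseteq> I" "I \<subseteq> verts G" "independent G I"
    "\<And>v. v \<in> verts G - I \<Longrightarrow> \<exists>w\<in>I. {v, w} \<in> edges G"
proof -
  let ?A = "{I. I \<subseteq> verts G \<and> independent G I}"
  have "finite ?A" using assms(1) by simp
  then obtain I where I: "I \<in> ?A" "I0 \<subseteq> I" "\<And>J. J \<in> ?A \<Longrightarrow> I \<subseteq> J \<Longrightarrow> I = J"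
    using finite_has_maximal2[of ?A I0] assms by auto
  show ?thesis
  proof (rule that)
    fix v assume v: "v \<in> verts G - I"
    show "\<exists>w\<in>I. {v, w} \<in> edges G"
    proof (rule ccontr)
      assume *: "\<not> (\<exists>w\<in>I. {v, w} \<in> edges G)"
      have "independent G (insert v I)"
        using I(1) * edge_facts[OF assms(4)] unfolding independent_def by blast
      then show False using I(3)[of "insert v I"] I(1) v by blast
    qed
  qed (use I in auto)
qed

lemma mdeg_image_mset_set:
  assumes "finite C"
  shows "mdeg (image_mset h (mset_set C)) x = card {v \<in> C. x \<in> h v}"
  unfolding mdeg_def by (simp add: filter_mset_image_mset assms)

text \<open>The obstruction to the exchange property. Extend the independent set
  \<open>{a, a', b, b'}\<close> to a maximal independent set \<open>I\<close>, let
  \<open>C\<close> be the complement, and give the vertices of \<open>C\<close> capacity one and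
  those of \<open>I\<close> ample capacity. Each vertex of the cover \<open>C\<close> has a
  neighbour in \<open>I\<close>, so the maximum matchings are those which match every vertex of
  \<open>C\<close> into \<open>I\<close>; in particular, they arise from choice functions
  \<open>f\<close> on \<open>C\<close>.

  Let \<open>D\<close> be the branch at \<open>u\<close> containing \<open>y\<close>. The
  vertices of \<open>C \<inter> D\<close> can be matched only into \<open>I \<inter> D\<close>,
  because the only way out of \<open>D\<close> leads to \<open>u \<in> C\<close>. Hence every
  maximum matching has total degree at least \<open>card (C \<inter> D)\<close> on
  \<open>I \<inter> D\<close>, with equality if \<open>u\<close> is matched outside
  \<open>D\<close>. Take two choice functions that send \<open>v1\<close> to \<open>a\<close> or
  \<open>a'\<close> and \<open>v2\<close> to \<open>b\<close> or \<open>b'\<close>, agree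
  elsewhere, and send \<open>u\<close> out of \<open>D\<close>. Exchanging \<open>a\<close> for
  \<open>b'\<close> would take one unit out of \<open>I \<inter> D\<close>, which is impossible.\<close>
lemma exchange_obstruction:
  assumes G: "tree G" and uy: "{u, y} \<in> edges G" and ub: "{u, b} \<in> edges G" "b \<noteq> y"
    and v1: "v1 \<in> branch G u y" "{v1, a} \<in> edges G" "{v1, a'} \<in> edges G" "a \<noteq> a'"
      "a \<in> branch G u y" "a' \<in> branch G u y"
    and v2: "v2 \<notin> branch G u y" "{v2, b} \<in> edges G" "{v2, b'} \<in> edges G" "b \<noteq> b'"
      "b' \<notin> branch G u y" "b' \<noteq> u"
  shows "\<exists>c. (\<forall>v\<in>verts G. c v > 0) \<and> \<not> exchange_property G c"
proof -
  define D where "D = branch G u y"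
  note simple = tree_simple[OF G]
  note ed = edge_facts[OF simple]
  have finV: "finite (verts G)" using simple by (simp add: simple_graph_def)
  have uD: "u \<notin> D" unfolding D_def using ed(1)[OF uy] by (intro branch_avoids) simp
  have step: "w \<in> D \<longleftrightarrow> x \<in> D" if "{x, w} \<in> edges G" "x \<noteq> u" "w \<noteq> u" for x w
    using branch_step[of x G u y w] branch_step[of w G u y x] that ed(4) unfolding D_def by blast
  have bD: "b \<notin> D" unfolding D_def using tree_branch_neighbour[OF G uy ub(1)] ub(2) by blast
  have D: "v1 \<in> D" "a \<in> D" "a' \<in> D" "v2 \<notin> D" "b' \<notin> D" using v1 v2 by (simp_all add: D_def)
  have nu: "v1 \<noteq> u" "a \<noteq> u" "a' \<noteq> u" "b \<noteq> u" "b' \<noteq> u" using D uD ed(1)[OF ub(1)] v2(6) by auto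
  have no_ab: "{x, w} \<notin> edges G" if "x \<in> {a, a'}" "w \<in> {b, b'}" for x w
    using step[of x w] that D bD nu by auto
  have "{a, a'} \<notin> edges G" "{b, b'} \<notin> edges G"
    using tree_no_triangle[OF G] v1(2,3) v2(2,3) ed(4) by blast+
  then have ind: "independent G {a, a', b, b'}"
    unfolding independent_def using no_ab ed(1,4) by blast
  have sub: "{a, a', b, b'} \<subseteq> verts G" using v1 v2 ed(3) by blast
  obtain I where I: "{a, a', b, b'} \<subseteq> I" "I \<subseteq> verts G" "independent G I"
      "\<And>v. v \<in> verts G - I \<Longrightarrow> \<exists>w\<in>I. {v, w} \<in> edges G"
    by (rule maximal_independent_extension[OF finV sub ind simple]) blast
  define C where "C = verts G - I"
  have finC: "finite C" using finV by (simp add: C_def)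
  have indep: "{x, w} \<notin> edges G" if "x \<in> I" "w \<in> I" for x w using I(3) that by (simp add: independent_def)
  have uI: "u \<notin> I" using indep[of u b] I(1) ub(1) by auto
  have v1C: "v1 \<in> C" and v2C: "v2 \<in> C"
    using indep[of v1 a] indep[of v2 b] I(1) v1(2) v2(2) ed(2) by (auto simp: C_def)
  have cover: "e \<inter> C \<noteq> {}" if e: "e \<in> edges G" for e
  proof -
    obtain x w where "e = {x, w}" "{x, w} \<in> edges G" using edgeE[OF simple e] by metis
    then show ?thesis using indep[of x w] ed(2,3) by (auto simp: C_def)
  qed
  obtain g where g: "\<And>v. v \<in> C \<Longrightarrow> g v \<in> I \<and> {v, g v} \<in> edges G"
    using I(4) unfolding C_def by metis
  \<comment> \<open>A vertex of \<open>I\<close> is chosen by at most \<open>card C\<close> vertices, so this capacity is no restriction.\<close>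
  define c where "c = (\<lambda>v. if v \<in> C then 1 else card C)"
  define M where "M = (\<lambda>f. image_mset (\<lambda>v. {v, f v}) (mset_set C))"
  define ok where "ok = (\<lambda>f. \<forall>v\<in>C. f v \<in> I \<and> {v, f v} \<in> edges G \<and> (f v \<in> D \<longleftrightarrow> v \<in> D))"
  have sizeM: "size (M f) = card C" for f by (simp add: M_def)
  have degM: "mdeg (M f) x = card {v \<in> C. f v = x}" if "x \<notin> C" for f x
    unfolding M_def mdeg_image_mset_set[OF finC] using that by (intro arg_cong[where f = card]) auto
  have degM1: "mdeg (M f) x = 1" if "ok f" "x \<in> C" for f x
  proof -
    have "{v \<in> C. x \<in> {v, f v}} = {x}" using that by (auto simp: ok_def C_def)
    then show ?thesis by (simp add: M_def mdeg_image_mset_set[OF finC])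
  qed
  have CV: "C \<subseteq> verts G" by (simp add: C_def)
  have sumc: "(\<Sum>v\<in>C. c v) = card C" by (simp add: c_def)
  have bm: "b_matching G c (M f)" if "ok f" for f
    unfolding b_matching_def
  proof (intro conjI ballI)
    show "set_mset (M f) \<subseteq> edges G" using that finC by (auto simp: M_def ok_def)
    fix v assume "v \<in> verts G"
    show "mdeg (M f) v \<le> c v"
      using degM[of v f] degM1[OF that, of v] card_mono[OF finC, of "{x \<in> C. f x = v}"]
      by (cases "v \<in> C") (auto simp: c_def)
  qed
  have max: "max_b_matching G c (M f)" if "ok f" for f
    unfolding max_b_matching_def sizeM
    using bm[OF that] size_le_cover[OF finC CV cover] sumc by metis
  \<comment> \<open>The update at \<open>u\<close> comes first: it has to give way when \<open>u = v2\<close>.\<close>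
  define f f' where "f = (g(u := b))(v1 := a, v2 := b)" and "f' = (g(u := b))(v1 := a', v2 := b')"
  have gD: "g v \<in> D \<longleftrightarrow> v \<in> D" if "v \<in> C" "v \<noteq> u" for v
    using step[of v "g v"] g[OF that(1)] that(2) uI by metis
  have v12: "v1 \<noteq> v2" using D by auto
  have ok_upd: "ok ((g(u := b))(v1 := p, v2 := q))"
    if "p \<in> I" "{v1, p} \<in> edges G" "p \<in> D" "q \<in> I" "{v2, q} \<in> edges G" "q \<notin> D" for p q
    unfolding ok_def
  proof (intro ballI)
    fix v assume v: "v \<in> C"
    have "b \<in> I" using I(1) by simp
    consider "v = v2" | "v = v1" "v \<noteq> v2" | "v = u" "v \<noteq> v1" "v \<noteq> v2" | "v \<noteq> u" "v \<noteq> v1" "v \<noteq> v2"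
      by blast
    then show "((g(u := b))(v1 := p, v2 := q)) v \<in> I \<and> {v, ((g(u := b))(v1 := p, v2 := q)) v} \<in> edges G
        \<and> (((g(u := b))(v1 := p, v2 := q)) v \<in> D \<longleftrightarrow> v \<in> D)"
    proof cases
      case 1 then show ?thesis using that D(4) by simp
    next
      case 2 then show ?thesis using that D(1) by simp
    next
      case 3 then show ?thesis using \<open>b \<in> I\<close> ub(1) bD uD by simp
    next
      case 4 then show ?thesis using g[OF v] gD[OF v] by simp
    qed
  qed
  have okf: "ok f" "ok f'"
    unfolding f_def f'_def using I(1) D bD v1(2,3) v2(2,3) by (auto intro!: ok_upd)
  have val: "f v1 = a" "f' v1 = a'" "f v2 = b" "f' v2 = b'" using v12 by (simp_all add: f_def f'_def)
  have agree: "f v = f' v" if "v \<noteq> v1" "v \<noteq> v2" for v using that by (simp add: f_def f'_def)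
  have ab: "a \<noteq> b'" using D by auto
  have imp_a: "f v = a" if "f' v = a" for v
    using that val agree[of v] v1(4) ab by (cases "v = v1"; cases "v = v2") auto
  have imp_b: "f' v = b'" if "f v = b'" for v
    using that val agree[of v] v2(4) ab by (cases "v = v1"; cases "v = v2") auto
  have a: "mdeg (M f') a < mdeg (M f) a"
  proof -
    have "{v \<in> C. f' v = a} \<subset> {v \<in> C. f v = a}"
    proof (rule psubsetI)
      show "{v \<in> C. f' v = a} \<subseteq> {v \<in> C. f v = a}" using imp_a by blast
      have "v1 \<in> {v \<in> C. f v = a}" "v1 \<notin> {v \<in> C. f' v = a}" using v1C val v1(4) by simp_all
      then show "{v \<in> C. f' v = a} \<noteq> {v \<in> C. f v = a}" by blast
    qed
    moreover have "a \<notin> C" using I(1) by (simp add: C_def)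
    ultimately show ?thesis using finC by (simp add: degM psubset_card_mono)
  qed
  have b: "mdeg (M f) b' < mdeg (M f') b'"
  proof -
    have "{v \<in> C. f v = b'} \<subset> {v \<in> C. f' v = b'}"
    proof (rule psubsetI)
      show "{v \<in> C. f v = b'} \<subseteq> {v \<in> C. f' v = b'}" using imp_b by blast
      have "v2 \<in> {v \<in> C. f' v = b'}" "v2 \<notin> {v \<in> C. f v = b'}" using v2C val v2(4) by simp_all
      then show "{v \<in> C. f v = b'} \<noteq> {v \<in> C. f' v = b'}" by blast
    qed
    moreover have "b' \<notin> C" using I(1) by (simp add: C_def)
    ultimately show ?thesis using finC by (simp add: degM psubset_card_mono)
  qed
  have "\<not> exchange_property G c"
  proof
    assume "exchange_property G c"
    then obtain N where N: "max_b_matching G c N"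
      "\<And>v. mdeg N v + (if v = a then 1 else 0) = mdeg (M f) v + (if v = b' then 1 else 0)"
      using max[OF okf(1)] max[OF okf(2)] a b unfolding exchange_property_def by metis
    have finS: "finite (I \<inter> D)" "finite (C \<inter> D)" using finV finC I(2) by (auto intro: finite_subset)
    have Nb: "b_matching G c N" and sizeN: "size N = (\<Sum>v\<in>C. c v)"
      using N(1) max[OF okf(1)] max_b_matching_size_eq[of G c "M f" N] sizeM sumc by auto
    have tight1: "mdeg N v = c v" if "v \<in> C" for v
      by (rule cover_tight(1)[OF finC CV _ Nb sizeN that]) (rule cover)
    have tight2: "card (e \<inter> C) = 1" if "e \<in># N" for e
      by (rule cover_tight(2)[OF finC CV _ Nb sizeN that]) (rule cover)
    \<comment> \<open>The lower bound on \<open>I \<inter> D\<close> for the matching that the exchange would produce.\<close>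
    have "card (C \<inter> D) = (\<Sum>v\<in>C \<inter> D. mdeg N v)" using tight1 by (simp add: c_def)
    also have "\<dots> = (\<Sum>e\<in>#N. card (e \<inter> (C \<inter> D)))" by (rule sum_mdeg[OF finS(2)])
    also have "\<dots> \<le> (\<Sum>e\<in>#N. card (e \<inter> (I \<inter> D)))"
    proof (rule sum_mset_mono)
      fix e assume e: "e \<in># N"
      then have eG: "e \<in> edges G" using Nb by (auto simp: b_matching_def)
      obtain v where v: "e \<inter> C = {v}" using tight2[OF e] by (auto simp: card_1_singleton_iff)
      obtain w where w: "e = {v, w}" "v \<noteq> w" "{v, w} \<in> edges G"
        using edgeE[OF simple eG] v by (metis insert_commute insert_iff Int_iff singletonI singletonD empty_iff)
      have wI: "w \<in> I" using v w ed(3)[OF w(3)] by (auto simp: C_def)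
      have "w \<in> D" if "v \<in> D" using step[OF w(3)] that uD uI wI by metis
      then show "card (e \<inter> (C \<inter> D)) \<le> card (e \<inter> (I \<inter> D))"
        using w(1,2) wI v by (cases "v \<in> D") (auto intro!: card_mono simp: C_def insert_absorb Int_insert_left)
    qed
    also have "\<dots> = (\<Sum>v\<in>I \<inter> D. mdeg N v)" by (rule sum_mdeg[OF finS(1), symmetric])
    finally have 1: "card (C \<inter> D) \<le> (\<Sum>v\<in>I \<inter> D. mdeg N v)" .
    have "(\<Sum>v\<in>I \<inter> D. mdeg N v + (if v = a then 1 else 0)) = (\<Sum>v\<in>I \<inter> D. mdeg (M f) v)"
      unfolding N(2) using D by (intro sum.cong) auto
    then have 2: "(\<Sum>v\<in>I \<inter> D. mdeg N v) + 1 = (\<Sum>v\<in>I \<inter> D. mdeg (M f) v)"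
      using finS D I(1) by (simp add: sum.distrib)
    \<comment> \<open>For the matching of \<open>f\<close> the lower bound is attained, so nothing can be taken away.\<close>
    have "(\<Sum>v\<in>I \<inter> D. mdeg (M f) v) = (\<Sum>v\<in>C. card ({v, f v} \<inter> (I \<inter> D)))"
      unfolding sum_mdeg[OF finS(1)] by (simp add: M_def image_mset.compositionality comp_def sum_unfold_sum_mset)
    also have "\<dots> = (\<Sum>v\<in>C. if v \<in> D then 1 else 0)"
    proof (rule sum.cong)
      fix v assume v: "v \<in> C"
      then have "{v, f v} \<inter> (I \<inter> D) = (if v \<in> D then {f v} else {})"
        using okf(1) by (auto simp: ok_def C_def)
      then show "card ({v, f v} \<inter> (I \<inter> D)) = (if v \<in> D then 1 else 0)" by simp
    qed simp
    also have "\<dots> = card (C \<inter> D)" using finC by (simp add: sum.If_cases)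
    finally show False using 1 2 by simp
  qed
  moreover have "c v > 0" for v using finC v1C by (auto simp: c_def card_gt_0_iff)
  ultimately show ?thesis by blast
qed

text \<open>Every neighbour of \<open>u\<close> has at most one further neighbour, and this one is a leaf.
  For trees this is the intrinsic form of a star graph with pendant edges attached.\<close>
definition spider_at :: "'v ugraph \<Rightarrow> 'v \<Rightarrow> bool" where
  "spider_at G u \<longleftrightarrow> u \<in> verts G \<and>
     (\<forall>y z w. {u, y} \<in> edges G \<longrightarrow> {y, z} \<in> edges G \<longrightarrow> z \<noteq> u \<longrightarrow> {z, w} \<in> edges G \<longrightarrow> w = y) \<and>
     (\<forall>y z z'. {u, y} \<in> edges G \<longrightarrow> {y, z} \<in> edges G \<longrightarrow> {y, z'} \<in> edges G \<longrightarrow>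
        z \<noteq> u \<longrightarrow> z' \<noteq> u \<longrightarrow> z = z')"

text \<open>The obstruction is applied with \<open>v2 = u\<close>. Besides a given neighbour
  \<open>y\<close> there are two more neighbours of \<open>u\<close>, so no vertex in the branch
  of \<open>y\<close> may have two neighbours in that branch. Looking at \<open>y\<close> and at
  its neighbours, this leaves just a vertex or an edge.\<close>
lemma spider_of_branching:
  assumes G: "tree G" and ex: "\<And>c. (\<forall>v\<in>verts G. c v > 0) \<Longrightarrow> exchange_property G c"
    and u: "{u, y1} \<in> edges G" "{u, y2} \<in> edges G" "{u, y3} \<in> edges G" "distinct [y1, y2, y3]"
  shows "spider_at G u"
proof -
  note ed = edge_facts[OF tree_simple[OF G]]
  have others: "\<exists>b b'. {u, b} \<in> edges G \<and> {u, b'} \<in> edges G \<and> b \<noteq> y \<and> b' \<noteq> y \<and> b \<noteq> b'" for y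
    using u by (cases "y = y1"; cases "y = y2") auto
  have no: False if y: "{u, y} \<in> edges G" and v: "v \<in> branch G u y" "{v, a} \<in> edges G" "{v, a'} \<in> edges G" "a \<noteq> a'"
    "a \<noteq> u" "a' \<noteq> u" for y v a a'
  proof -
    obtain b b' where b: "{u, b} \<in> edges G" "{u, b'} \<in> edges G" "b \<noteq> y" "b' \<noteq> y" "b \<noteq> b'"
      using others by metis
    have "u \<notin> branch G u y" using branch_avoids ed(1)[OF y] by metis
    moreover from this v have "a \<in> branch G u y" "a' \<in> branch G u y"
      using branch_step[of v G u y] by metis+
    moreover have "b' \<notin> branch G u y" using tree_branch_neighbour[OF G y b(2)] b(4) by blast
    moreover have "b' \<noteq> u" using ed(1)[OF b(2)] by simp
    ultimately show False using exchange_obstruction[OF G y b(1,3) v(1,2,3,4), of u b'] b ex by blast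
  qed
  have far: "w = y" if y: "{u, y} \<in> edges G" and z: "{y, z} \<in> edges G" "z \<noteq> u" "{z, w} \<in> edges G" for y z w
  proof (rule ccontr)
    assume "w \<noteq> y"
    have yu: "y \<noteq> u" using ed(1)[OF y] by simp
    have "z \<in> branch G u y" using branch_step[OF branch_self yu z(1,2)] .
    moreover have "w \<noteq> u" using tree_no_triangle[OF G y z(1)] z(3) by blast
    ultimately show False using no[OF y, of z y w] z ed(4) yu \<open>w \<noteq> y\<close> by blast
  qed
  show ?thesis
    unfolding spider_at_def using far no[OF _ branch_self] ed(2)[OF u(1)] by blast
qed

definition is_path :: "'v ugraph \<Rightarrow> 'v list \<Rightarrow> bool" where
  "is_path G p \<longleftrightarrow> distinct p \<and> set p \<subseteq> verts G \<and> (\<forall>i. Suc i < length p \<longrightarrow> {p ! i, p ! Suc i} \<in> edges G)"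

text \<open>In a path with vertices numbered from zero to six, the obstruction is applied at
  \<open>u = 3\<close>, \<open>y = 2\<close> and \<open>b = 4\<close>, with
  \<open>v1 = 1\<close> between \<open>0, 2\<close>, and \<open>v2 = 5\<close> between
  \<open>4, 6\<close>.\<close>
lemma path_length_le_six:
  assumes G: "tree G" and ex: "\<And>c. (\<forall>v\<in>verts G. c v > 0) \<Longrightarrow> exchange_property G c"
    and p: "is_path G p"
  shows "length p \<le> 6"
proof (rule ccontr)
  assume "\<not> length p \<le> 6"
  then have len: "7 \<le> length p" by simp
  note ed = edge_facts[OF tree_simple[OF G]]
  have e: "{p ! i, p ! Suc i} \<in> edges G" if "i < 6" for i using p len that by (simp add: is_path_def)
  have d: "p ! i = p ! j \<longleftrightarrow> i = j" if "i < 7" "j < 7" for i j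
    using p len that by (simp add: is_path_def nth_eq_iff_index_eq)
  have e': "{p ! 0, p ! 1} \<in> edges G" "{p ! 1, p ! 2} \<in> edges G" "{p ! 2, p ! 3} \<in> edges G"
     "{p ! 3, p ! 4} \<in> edges G" "{p ! 4, p ! 5} \<in> edges G" "{p ! 5, p ! 6} \<in> edges G"
    using e[of 0] e[of 1] e[of 2] e[of 3] e[of 4] e[of 5] by (simp_all add: eval_nat_numeral)
  let ?D = "branch G (p ! 3) (p ! 2)"
  have step: "p ! j \<in> ?D" if "p ! i \<in> ?D" "{p ! i, p ! j} \<in> edges G" "i \<noteq> 3" "j \<noteq> 3" "i < 7" "j < 7" for i j
    using branch_step[OF that(1) _ that(2)] d[of i 3] d[of j 3] that by simp
  have D: "p ! 2 \<in> ?D" by (rule branch_self)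
  have D1: "p ! 1 \<in> ?D" using step[OF D] ed(4)[OF e'(2)] by simp
  have D0: "p ! 0 \<in> ?D" using step[OF D1] ed(4)[OF e'(1)] by simp
  have D4: "p ! 4 \<notin> ?D" using tree_branch_neighbour[OF G ed(4)[OF e'(3)] e'(4)] d[of 4 2] by auto
  have D5: "p ! 5 \<notin> ?D" using step[of 5 4] D4 ed(4)[OF e'(5)] by auto
  have D6: "p ! 6 \<notin> ?D" using step[of 6 5] D5 ed(4)[OF e'(6)] by auto
  show False
    using exchange_obstruction[OF G ed(4)[OF e'(3)] e'(4) _ D1 ed(4)[OF e'(1)] e'(2) _ D0 D D5 ed(4)[OF e'(5)] e'(6) _ D6]
      d[of 4 2] d[of 0 2] d[of 4 6] d[of 6 3] ex by auto
qed

text \<open>A longest path cannot be left: at its ends because it is longest, and in between because the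
  two neighbours of an inner vertex are already on it. By connectedness it meets all vertices,
  and a further edge between two of its vertices would close a cycle.\<close>
lemma spanning_path_of_degree_le_two:
  assumes G: "tree G"
    and deg: "\<And>u y1 y2 y3. {u, y1} \<in> edges G \<Longrightarrow> {u, y2} \<in> edges G \<Longrightarrow> {u, y3} \<in> edges G \<Longrightarrow> \<not> distinct [y1, y2, y3]"
  obtains p where "is_path G p" "set p = verts G" "2 \<le> length p"
    "edges G = {{p ! i, p ! Suc i} |i. Suc i < length p}"
proof -
  note simple = tree_simple[OF G]
  note ed = edge_facts[OF simple]
  have finV: "finite (verts G)" using simple by (simp add: simple_graph_def)
  obtain v w where vw: "{v, w} \<in> edges G"
    using G edgeE[OF simple] unfolding tree_def connected_graph_def simple_graph_def by (metis ex_in_conv)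
  have path2: "is_path G [v, w]" using vw ed by (auto simp: is_path_def)
  have "length p < Suc (card (verts G))" if "is_path G p" for p
    using that card_mono[OF finV, of "set p"] by (auto simp: is_path_def distinct_card less_Suc_eq_le)
  then obtain p where p: "is_path G p" and max: "\<And>q. is_path G q \<Longrightarrow> length q \<le> length p"
    using ex_has_greatest_nat[of "is_path G" "[v, w]" length "Suc (card (verts G))"] path2 by metis
  have len: "2 \<le> length p" using max[OF path2] by simp
  have pd: "distinct p" "set p \<subseteq> verts G" and pe: "\<And>i. Suc i < length p \<Longrightarrow> {p ! i, p ! Suc i} \<in> edges G"
    using p by (auto simp: is_path_def)
  have nth_eq: "p ! i = p ! j \<longleftrightarrow> i = j" if "i < length p" "j < length p" for i j
    using nth_eq_iff_index_eq[OF pd(1)] that by blast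
  have interior: "w = p ! (i - 1) \<or> w = p ! Suc i" if "0 < i" "Suc i < length p" "{p ! i, w} \<in> edges G" for i w
  proof -
    have "{p ! (i - 1), p ! i} \<in> edges G" using pe[of "i - 1"] that by simp
    then have "{p ! i, p ! (i - 1)} \<in> edges G" by (rule ed(4))
    then have "\<not> distinct [p ! (i - 1), p ! Suc i, w]" using deg pe[OF that(2)] that(3) by blast
    moreover have "p ! (i - 1) \<noteq> p ! Suc i" using nth_eq[of "i - 1" "Suc i"] that by simp
    ultimately show ?thesis by auto
  qed
  have closed: "w \<in> set p" if x: "i < length p" "{p ! i, w} \<in> edges G" for i w
  proof (rule ccontr)
    assume w: "w \<notin> set p"
    consider "i = 0" | "Suc i = length p" | "0 < i" "Suc i < length p" using x(1) by linarith
    then show False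
    proof cases
      case 1
      have "is_path G (w # p)"
        unfolding is_path_def
      proof (intro conjI allI impI)
        fix j assume "Suc j < length (w # p)"
        then show "{(w # p) ! j, (w # p) ! Suc j} \<in> edges G"
          using ed(4)[OF x(2)] 1 pe by (cases j) auto
      qed (use w pd ed(3)[OF x(2)] in auto)
      then show False using max by force
    next
      case 2
      have "is_path G (p @ [w])"
        unfolding is_path_def
      proof (intro conjI allI impI)
        fix j assume j: "Suc j < length (p @ [w])"
        then have "j = i" if "\<not> Suc j < length p" using 2 that by simp
        then show "{(p @ [w]) ! j, (p @ [w]) ! Suc j} \<in> edges G"
          using x(2) 2 pe[of j] j by (cases "Suc j < length p") (auto simp: nth_append)
      qed (use w pd ed(3)[OF x(2)] in auto)
      then show False using max by force
    next
      case 3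
      then have "i - 1 < length p" "Suc i < length p" by auto
      then show False using interior[OF 3 x(2)] w by (metis nth_mem)
    qed
  qed
  have cons: "j = Suc i" if ij: "i < j" "j < length p" "{p ! i, p ! j} \<in> edges G" for i j
  proof (cases "i = 0")
    case False
    then show ?thesis using interior[of i "p ! j"] ij nth_eq[of j "i - 1"] nth_eq[of j "Suc i"] by auto
  next
    case True
    show ?thesis
    proof (rule ccontr)
      assume "j \<noteq> Suc i"
      then have j: "2 \<le> j" using ij True by simp
      have "is_cycle G (take (Suc j) p)"
        unfolding is_cycle_def
      proof (intro conjI allI impI)
        show "3 \<le> length (take (Suc j) p)" "distinct (take (Suc j) p)" using j ij pd by auto
        show "set (take (Suc j) p) \<subseteq> verts G" using pd(2) set_take_subset by fast
        fix k assume "k < length (take (Suc j) p)"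
        then have k: "k \<le> j" by simp
        show "{take (Suc j) p ! k, take (Suc j) p ! (Suc k mod length (take (Suc j) p))} \<in> edges G"
          using k pe[of k] ij ed(4)[OF ij(3)] True by (cases "k = j") auto
      qed
      then show False using G by (auto simp: tree_def)
    qed
  qed
  have "verts G \<subseteq> set p"
  proof
    fix x assume x: "x \<in> verts G"
    have "p ! 0 \<in> verts G" using pd(2) len by (metis nth_mem subsetD less_le_trans zero_less_numeral)
    then have "(p ! 0, x) \<in> {(x, y). {x, y} \<in> edges G}\<^sup>*"
      using G x unfolding tree_def connected_graph_def by blast
    then show "x \<in> set p"
    proof induction
      case base show ?case using len by (auto intro: nth_mem)
    next
      case (step y z) then show ?case using closed by (auto simp: in_set_conv_nth)
    qed
  qed
  then have V: "set p = verts G" using pd(2) by blast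
  have "edges G = {{p ! i, p ! Suc i} |i. Suc i < length p}"
  proof (intro equalityI subsetI)
    fix e assume e: "e \<in> edges G"
    then obtain x y where xy: "e = {x, y}" "x \<noteq> y" using edgeE[OF simple] by metis
    then have "x \<in> set p" "y \<in> set p" using V ed(2,3) e by blast+
    then obtain i j where ij: "x = p ! i" "i < length p" "y = p ! j" "j < length p" by (metis in_set_conv_nth)
    show "e \<in> {{p ! i, p ! Suc i} |i. Suc i < length p}"
    proof (cases "i < j")
      case True
      then have "j = Suc i" using cons[of i j] ij xy e by simp
      then show ?thesis using xy ij by blast
    next
      case False
      then have "j < i" using xy ij by (metis linorder_neqE_nat)
      then have "i = Suc j" using cons[of j i] ij xy e by (simp add: insert_commute)
      then show ?thesis using xy ij by (auto intro!: exI[of _ j])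
    qed
  qed (use pe in auto)
  then show ?thesis using that p V len by blast
qed

lemma graph_iso_path_graph:
  assumes "distinct p" "set p = verts G" "edges G = {{p ! i, p ! Suc i} |i. Suc i < length p}"
  shows "graph_iso G (path_graph (length p))"
proof -
  define f where "f = (\<lambda>x. Suc (the_inv_into {..<length p} (nth p) x))"
  have inj: "inj_on (nth p) {..<length p}" using assms(1) by (simp add: inj_on_nth)
  have f: "f (p ! i) = Suc i" if "i < length p" for i
    unfolding f_def using the_inv_into_f_f[OF inj] that by simp
  have "bij_betw f (verts G) {1..length p}"
  proof (rule bij_betw_byWitness[where f' = "\<lambda>i. p ! (i - 1)"])
    show "\<forall>a\<in>verts G. p ! (f a - 1) = a" "f ` verts G \<subseteq> {1..length p}"
      unfolding assms(2)[symmetric] by (auto simp: in_set_conv_nth f)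
    show "\<forall>i\<in>{1..length p}. f (p ! (i - 1)) = i" by (auto simp: f)
    show "(\<lambda>i. p ! (i - 1)) ` {1..length p} \<subseteq> verts G" unfolding assms(2)[symmetric] by auto
  qed
  moreover have "(\<lambda>e. f ` e) ` edges G = {{i, i + 1} |i. 1 \<le> i \<and> i < length p}"
  proof (intro equalityI subsetI)
    fix e assume "e \<in> (\<lambda>e. f ` e) ` edges G"
    then obtain i where "e = f ` {p ! i, p ! Suc i}" "Suc i < length p" unfolding assms(3) by blast
    then show "e \<in> {{i, i + 1} |i. 1 \<le> i \<and> i < length p}" by (auto simp: f intro!: exI[of _ "Suc i"])
  next
    fix e assume "e \<in> {{i, i + 1} |i. 1 \<le> i \<and> i < length p}"
    then obtain i where i: "e = {i, i + 1}" "1 \<le> i" "i < length p" by blast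
    then have "e = f ` {p ! (i - 1), p ! Suc (i - 1)}" by (simp add: f)
    moreover have "{p ! (i - 1), p ! Suc (i - 1)} \<in> edges G" unfolding assms(3) using i by (auto intro!: exI[of _ "i - 1"])
    ultimately show "e \<in> (\<lambda>e. f ` e) ` edges G" by blast
  qed
  ultimately show ?thesis unfolding graph_iso_def path_graph_def by auto
qed

lemma exchange_imp_spider_or_path:
  assumes G: "tree G" and ex: "\<And>c. (\<forall>v\<in>verts G. c v > 0) \<Longrightarrow> exchange_property G c"
  shows "(\<exists>u. spider_at G u) \<or> graph_iso G (path_graph 6)"
proof (cases "\<exists>u y1 y2 y3. {u, y1} \<in> edges G \<and> {u, y2} \<in> edges G \<and> {u, y3} \<in> edges G \<and> distinct [y1, y2, y3]")
  case True
  then show ?thesis using spider_of_branching[OF G ex] by metis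
next
  case False
  then have deg: "\<not> distinct [y1, y2, y3]"
    if "{u, y1} \<in> edges G" "{u, y2} \<in> edges G" "{u, y3} \<in> edges G" for u y1 y2 y3
    using that by blast
  obtain p where p: "is_path G p" "set p = verts G" "2 \<le> length p"
    "edges G = {{p ! i, p ! Suc i} |i. Suc i < length p}"
    by (rule spanning_path_of_degree_le_two[OF G deg])
  have le: "length p \<le> 6" by (rule path_length_le_six[OF G ex p(1)])
  show ?thesis
  proof (cases "length p = 6")
    case True
    then show ?thesis using graph_iso_path_graph[of p G] p by (auto simp: is_path_def)
  next
    case False
    \<comment> \<open>A path with at most five vertices is a spider around its middle vertex.\<close>
    define m where "m = length p div 2"
    let ?n = "length p"
    have m: "m < ?n" "m \<le> 2" "?n \<le> m + 3" using p(3) le False by (auto simp: m_def)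
    have nth_eq: "p ! i = p ! j \<longleftrightarrow> i = j" if "i < ?n" "j < ?n" for i j
      using p(1) that by (simp add: is_path_def nth_eq_iff_index_eq)
    have nbr: "\<exists>j < ?n. y = p ! j \<and> (j = Suc k \<or> k = Suc j)" if k: "k < ?n" "{p ! k, y} \<in> edges G" for k y
    proof -
      obtain i where i: "Suc i < ?n" "{p ! k, y} = {p ! i, p ! Suc i}" using k(2) unfolding p(4) by blast
      then consider "p ! k = p ! i" "y = p ! Suc i" | "p ! k = p ! Suc i" "y = p ! i"
        by (auto simp: doubleton_eq_iff)
      then show ?thesis
      proof cases
        case 1
        then show ?thesis using nth_eq[OF k(1), of i] i(1) by auto
      next
        case 2
        then show ?thesis using nth_eq[OF k(1), of "Suc i"] i(1) by (intro exI[of _ i]) auto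
      qed
    qed
    have "spider_at G (p ! m)"
      unfolding spider_at_def
    proof (intro conjI allI impI)
      show "p ! m \<in> verts G" unfolding p(2)[symmetric] using m(1) by simp
    next
      fix y z w assume y: "{p ! m, y} \<in> edges G" and z: "{y, z} \<in> edges G" "z \<noteq> p ! m" and w: "{z, w} \<in> edges G"
      obtain j where j: "j < ?n" "y = p ! j" "j = Suc m \<or> m = Suc j" using nbr[OF m(1) y] by blast
      obtain k where k: "k < ?n" "z = p ! k" "k = Suc j \<or> j = Suc k" using nbr[OF j(1)] z(1) j(2) by blast
      obtain l where l: "l < ?n" "w = p ! l" "l = Suc k \<or> k = Suc l" using nbr[OF k(1)] w k(2) by blast
      have "k \<noteq> m" using z(2) k(2) by auto
      then have "l = j" using j k l m by linarith
      then show "w = y" using j l by simp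
    next
      fix y z z' assume y: "{p ! m, y} \<in> edges G" and z: "{y, z} \<in> edges G" "{y, z'} \<in> edges G" "z \<noteq> p ! m" "z' \<noteq> p ! m"
      obtain j where j: "j < ?n" "y = p ! j" "j = Suc m \<or> m = Suc j" using nbr[OF m(1) y] by blast
      obtain k where k: "k < ?n" "z = p ! k" "k = Suc j \<or> j = Suc k" using nbr[OF j(1)] z(1) j(2) by blast
      obtain l where l: "l < ?n" "z' = p ! l" "l = Suc j \<or> j = Suc l" using nbr[OF j(1)] z(2) j(2) by blast
      have "k \<noteq> m" "l \<noteq> m" using z k(2) l(2) by auto
      then have "k = l" using j k l by linarith
      then show "z = z'" using k l by simp
    qed
    then show ?thesis by blast
  qed
qed

section \<open>Exchange along alternating paths\<close>

text \<open>Replacing the edge \<open>{\<xi>, s}\<close> of \<open>M\<close> by \<open>{s, \<rho>}\<close>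
  moves one unit of degree from \<open>\<xi>\<close> to \<open>\<rho>\<close>. The last
  conclusion allows two such replacements to be composed.\<close>
lemma walk_step:
  assumes "set_mset M \<subseteq> edges G" "{\<xi>, s} \<in># M" "{s, \<rho>} \<in> edges G" "\<xi> \<noteq> s" "s \<noteq> \<rho>"
  obtains N where "set_mset N \<subseteq> edges G" "size N = size M"
    "\<And>v. mdeg N v + (if v = \<xi> then 1 else 0) = mdeg M v + (if v = \<rho> then 1 else 0)"
    "\<And>e. e \<in># M \<Longrightarrow> e \<noteq> {\<xi>, s} \<Longrightarrow> e \<in># N"
proof -
  obtain M0 where M0: "M = add_mset {\<xi>, s} M0" using multi_member_split[OF assms(2)] by blast
  show ?thesis
    by (rule that[of "add_mset {s, \<rho>} M0"]) (use assms M0 in auto)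
qed

lemma max_b_matchingD:
  assumes "max_b_matching G c M"
  shows "set_mset M \<subseteq> edges G" "v \<in> verts G \<Longrightarrow> mdeg M v \<le> c v"
    "b_matching G c M" "b_matching G c N \<Longrightarrow> size N \<le> size M"
  using assms by (auto simp: max_b_matching_def b_matching_def)

text \<open>The size is unchanged and only the degree of \<open>\<rho>\<close> grows, so a free unit at
  \<open>\<rho>\<close> is all that is needed for a maximum matching again.\<close>
lemma max_b_matching_shift:
  assumes M: "max_b_matching G c M" and \<rho>: "mdeg M \<rho> < c \<rho>" and N: "set_mset N \<subseteq> edges G" "size N = size M"
    "\<And>v. mdeg N v + (if v = \<xi> then 1 else 0) = mdeg M v + (if v = \<rho> then 1 else 0)"
  shows "max_b_matching G c N"
proof -
  have "mdeg N v \<le> c v" if "v \<in> verts G" for v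
    using N(3)[of v] max_b_matchingD(2)[OF M that] \<rho> by (auto split: if_splits)
  then have "b_matching G c N" using N(1) by (simp add: b_matching_def)
  then show ?thesis using max_b_matching_size_eq[OF M] N(2) by simp
qed

lemma exchange_two_walk:
  assumes M: "max_b_matching G c M" and \<rho>: "mdeg M \<rho> < c \<rho>"
    and e: "{\<xi>, s} \<in># M" "{s, \<rho>} \<in> edges G" "\<xi> \<noteq> s" "s \<noteq> \<rho>"
  shows "\<exists>N. max_b_matching G c N \<and>
        (\<forall>v. mdeg N v + (if v = \<xi> then 1 else 0) = mdeg M v + (if v = \<rho> then 1 else 0))"
  using walk_step[OF max_b_matchingD(1)[OF M] e] max_b_matching_shift[OF M \<rho>] by metis

lemma exchange_four_walk:
  assumes M: "max_b_matching G c M" and \<rho>: "mdeg M \<rho> < c \<rho>"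
    and e: "{\<xi>, s} \<in># M" "{s, t} \<in> edges G" "{t, s'} \<in># M" "{s', \<rho>} \<in> edges G"
    and d: "distinct [\<xi>, s, t, s', \<rho>]"
  shows "\<exists>N. max_b_matching G c N \<and>
        (\<forall>v. mdeg N v + (if v = \<xi> then 1 else 0) = mdeg M v + (if v = \<rho> then 1 else 0))"
proof -
  have ne: "t \<noteq> s'" "s' \<noteq> \<rho>" "{\<xi>, s} \<noteq> {t, s'}" "\<xi> \<noteq> s" "s \<noteq> t" using d by (auto simp: doubleton_eq_iff)
  obtain N where N: "set_mset N \<subseteq> edges G" "size N = size M"
    "\<And>v. mdeg N v + (if v = t then 1 else 0) = mdeg M v + (if v = \<rho> then 1 else 0)"
    "{\<xi>, s} \<in># N"
    by (rule walk_step[OF max_b_matchingD(1)[OF M] e(3,4) ne(1,2)]) (use e(1) ne(3) in blast)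
  obtain N' where N': "set_mset N' \<subseteq> edges G" "size N' = size N"
    "\<And>v. mdeg N' v + (if v = \<xi> then 1 else 0) = mdeg N v + (if v = t then 1 else 0)"
    by (rule walk_step[OF N(1,4) e(2) ne(4,5)]) blast
  have "mdeg N' v + (if v = \<xi> then 1 else 0) = mdeg M v + (if v = \<rho> then 1 else 0)" for v
    using N(3)[of v] N'(3)[of v] by simp
  moreover from this have "max_b_matching G c N'"
    using N' N(2) by (intro max_b_matching_shift[OF M \<rho>, of N' \<xi>]) auto
  ultimately show ?thesis by blast
qed

lemma max_b_matching_no_augment:
  assumes M: "max_b_matching G c M" and e: "{x, y} \<in> edges G"
  shows "c x \<le> mdeg M x \<or> c y \<le> mdeg M y"
proof (rule ccontr)
  assume "\<not> ?thesis"
  then have "mdeg M x < c x" "mdeg M y < c y" by auto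
  then have "b_matching G c (add_mset {x, y} M)"
    using max_b_matchingD(3)[OF M] e by (auto simp: b_matching_def Suc_le_eq)
  then show False using max_b_matchingD(4)[OF M] by force
qed

lemma mdeg_leaf_le:
  assumes "\<And>e. e \<in># M \<Longrightarrow> l \<in> e \<Longrightarrow> y \<in> e"
  shows "mdeg M l \<le> mdeg M y"
  unfolding mdeg_def using assms
  by (intro size_mset_mono filter_mset_mono_strong) auto

section \<open>Stars with pendant edges\<close>

lemma spider_atD:
  assumes "spider_at G u"
  shows "u \<in> verts G"
    "{u, y} \<in> edges G \<Longrightarrow> {y, z} \<in> edges G \<Longrightarrow> z \<noteq> u \<Longrightarrow> {z, w} \<in> edges G \<Longrightarrow> w = y"
    "{u, y} \<in> edges G \<Longrightarrow> {y, z} \<in> edges G \<Longrightarrow> {y, z'} \<in> edges G \<Longrightarrow> z \<noteq> u \<Longrightarrow> z' \<noteq> u \<Longrightarrow> z = z'"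
  using assms unfolding spider_at_def by blast+

lemma spider_far:
  assumes "simple_graph G" "spider_at G u" "{u, y} \<in> edges G" "{y, z} \<in> edges G" "z \<noteq> u"
  shows "{u, z} \<notin> edges G"
proof
  assume "{u, z} \<in> edges G"
  then have "u = y" using spider_atD(2)[OF assms(2-5)] edge_facts(4)[OF assms(1)] by blast
  then show False using edge_facts(1)[OF assms(1,3)] by simp
qed

lemma spider_verts:
  assumes G: "tree G" and u: "spider_at G u" and v: "v \<in> verts G"
  obtains "v = u" | "{u, v} \<in> edges G" | y where "{u, y} \<in> edges G" "{y, v} \<in> edges G" "v \<noteq> u"
proof -
  note ed = edge_facts[OF tree_simple[OF G]]
  have "(u, v) \<in> {(x, y). {x, y} \<in> edges G}\<^sup>*"
    using G v spider_atD(1)[OF u] unfolding tree_def connected_graph_def by blast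
  then have "v = u \<or> {u, v} \<in> edges G \<or> (\<exists>y. {u, y} \<in> edges G \<and> {y, v} \<in> edges G \<and> v \<noteq> u)"
  proof induction
    case (step x z)
    then have xz: "{x, z} \<in> edges G" by simp
    from step.IH show ?case
    proof (elim disjE exE conjE)
      fix y assume "{u, y} \<in> edges G" "{y, x} \<in> edges G" "x \<noteq> u"
      then show ?thesis using spider_atD(2)[OF u, of y x z] xz by blast
    qed (use xz in blast)+
  qed simp
  then show ?thesis using that by blast
qed

text \<open>Every edge of a spider has exactly one end among the neighbours of the centre
  \<open>u\<close>.\<close>
lemma spider_edge:
  assumes G: "tree G" and u: "spider_at G u" and e: "e \<in> edges G"
  obtains y where "{u, y} \<in> edges G" "e = {u, y}"
    | y z where "{u, y} \<in> edges G" "e = {y, z}" "{y, z} \<in> edges G" "z \<noteq> u"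
proof -
  note ed = edge_facts[OF tree_simple[OF G]]
  obtain a b where ab: "e = {a, b}" "{a, b} \<in> edges G" using edgeE[OF tree_simple[OF G] e] by metis
  have ba: "{b, a} \<in> edges G" by (rule ed(4)[OF ab(2)])
  show ?thesis
  proof (cases rule: spider_verts[OF G u ed(2)[OF ab(2)]])
    case 1
    then show ?thesis using that(1)[of b] ab by simp
  next
    case 2
    then show ?thesis using that(1)[of a] that(2)[of a b] ab by (cases "b = u") auto
  next
    case (3 y)
    then have "b = y" using spider_atD(2)[OF u 3 ab(2)] by simp
    then show ?thesis using that(2)[of b a] 3 ab ba by (simp add: insert_commute)
  qed
qed

lemma edge_other_end:
  assumes "simple_graph G" "e \<in> edges G" "v \<in> e"
  obtains w where "e = {v, w}" "{v, w} \<in> edges G"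
proof -
  obtain x y where xy: "e = {x, y}" "{x, y} \<in> edges G" using edgeE[OF assms(1,2)] by metis
  show ?thesis
  proof (cases "v = x")
    case True then show ?thesis using that xy by blast
  next
    case False
    then have "v = y" using assms(3) xy by simp
    then show ?thesis using that[of x] xy by (simp add: insert_commute)
  qed
qed

lemma mdeg_pos_edge:
  assumes "mdeg M v > 0" obtains e where "e \<in># M" "v \<in> e"
proof -
  have "{#e \<in># M. v \<in> e#} \<noteq> {#}" using assms unfolding mdeg_def by (metis less_irrefl size_empty)
  then obtain e where "e \<in># {#e \<in># M. v \<in> e#}" by (meson multiset_nonemptyE)
  then show ?thesis using that by auto
qed

text \<open>Let \<open>B\<close> be the set of neighbours of the centre \<open>u\<close>. If
  \<open>M\<close> saturates \<open>B\<close>, then \<open>B\<close> is a tight cover, and the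
  degrees of two maximum matchings differ only at \<open>u\<close> and at vertices of distance
  two. Otherwise the cover that consists of \<open>u\<close>, the saturated vertices of distance
  two, and the neighbours in \<open>B\<close> of the unsaturated ones is tight, and then the
  degrees differ only in \<open>B\<close>. In both cases the exchange is carried out along the
  path from \<open>\<xi>\<close> to \<open>\<rho>\<close>, where the inequalities between the
  degrees of \<open>M\<close> and \<open>M'\<close> show that the edges to be removed are
  present.\<close>
lemma exchange_spider:
  assumes G: "tree G" and u: "spider_at G u"
  shows "exchange_property G c"
  unfolding exchange_property_def
proof (intro allI impI)
  fix M M' \<xi> \<rho>
  assume M: "max_b_matching G c M" and M': "max_b_matching G c M'"
    and \<xi>: "mdeg M' \<xi> < mdeg M \<xi>" and \<rho>: "mdeg M \<rho> < mdeg M' \<rho>"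
  note simple = tree_simple[OF G]
  note ed = edge_facts[OF simple]
  note sub = max_b_matchingD(1)[OF M] and sub' = max_b_matchingD(1)[OF M']
  have finV: "finite (verts G)" using simple by (simp add: simple_graph_def)
  have \<xi>V: "\<xi> \<in> verts G" using \<xi> mdeg_outside[OF simple sub] by (metis not_less_zero)
  have \<rho>V: "\<rho> \<in> verts G" using \<rho> mdeg_outside[OF simple sub'] by (metis not_less_zero)
  have \<rho>c: "mdeg M \<rho> < c \<rho>" using \<rho> max_b_matchingD(2)[OF M' \<rho>V] by simp
  have ne: "\<xi> \<noteq> \<rho>" using \<xi> \<rho> by auto
  define B where "B = {y. {u, y} \<in> edges G}"
  have BV: "B \<subseteq> verts G" and uB: "u \<notin> B" using ed(3) ed(1)[of u u] by (auto simp: B_def)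
  have far: "z \<notin> B" if "y \<in> B" "{y, z} \<in> edges G" "z \<noteq> u" for y z
    using spider_far[OF simple u] that by (simp add: B_def)
  \<comment> \<open>The edges at a vertex of distance two all contain its only neighbour.\<close>
  have leaf_le: "mdeg K z \<le> mdeg K y" if sub: "set_mset K \<subseteq> edges G" and yz: "y \<in> B" "{y, z} \<in> edges G" "z \<noteq> u" for K y z
  proof (rule mdeg_leaf_le)
    fix e assume e: "e \<in># K" "z \<in> e"
    obtain w where "e = {z, w}" "{z, w} \<in> edges G"
      by (rule edge_other_end[OF simple _ e(2)]) (use e sub in blast)
    then show "y \<in> e" using spider_atD(2)[OF u, of y z w] yz by (simp add: B_def)
  qed
  \<comment> \<open>If the edge to the centre is not used, all edges at \<open>y\<close> go to its only other neighbour.\<close>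
  have le_leaf: "mdeg K y \<le> mdeg K z"
    if sub: "set_mset K \<subseteq> edges G" and yz: "y \<in> B" "{y, z} \<in> edges G" "z \<noteq> u" "{u, y} \<notin># K" for K y z
  proof (rule mdeg_leaf_le)
    fix e assume e: "e \<in># K" "y \<in> e"
    obtain w where w: "e = {y, w}" "{y, w} \<in> edges G"
      by (rule edge_other_end[OF simple _ e(2)]) (use e sub in blast)
    moreover have "w \<noteq> u" using yz(4) e w by (auto simp: insert_commute)
    ultimately show "z \<in> e" using spider_atD(3)[OF u, of y z w] yz by (simp add: B_def)
  qed
  show "\<exists>N. max_b_matching G c N \<and>
      (\<forall>v. mdeg N v + (if v = \<xi> then 1 else 0) = mdeg M v + (if v = \<rho> then 1 else 0))"
  proof (cases "\<forall>y\<in>B. mdeg M y = c y")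
    case True
    have finB: "finite B" using finV BV by (rule finite_subset[rotated])
    have cover: "e \<inter> B \<noteq> {}" if "e \<in> edges G" for e
      by (cases rule: spider_edge[OF G u that]) (auto simp: B_def)
    have card1: "card (e \<inter> B) = 1" if e: "e \<in> edges G" for e
    proof (cases rule: spider_edge[OF G u e])
      case (1 y)
      then have "e \<inter> B = {y}" using uB by (auto simp: B_def)
      then show ?thesis by simp
    next
      case (2 y z)
      then have "e \<inter> B = {y}" using far[of y z] by (auto simp: B_def)
      then show ?thesis by simp
    qed
    have "size M = (\<Sum>e\<in>#M. 1)" by simp
    also have "\<dots> = (\<Sum>e\<in>#M. card (e \<inter> B))"
      using card1 sub by (intro arg_cong[where f = sum_mset] image_mset_cong) (simp add: subset_iff)
    also have "\<dots> = (\<Sum>y\<in>B. c y)" using True by (simp add: sum_mdeg[OF finB, symmetric])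
    finally have sizeM: "size M = (\<Sum>y\<in>B. c y)" .
    then have sizeM': "size M' = (\<Sum>y\<in>B. c y)" using max_b_matching_size_eq[OF M] M' by simp
    have sat: "mdeg M' y = c y" if "y \<in> B" for y
      by (rule cover_tight(1)[OF finB BV _ max_b_matchingD(3)[OF M'] sizeM' that]) (rule cover)
    have notB: "\<xi> \<notin> B" "\<rho> \<notin> B" using \<xi> \<rho> True sat by auto
    obtain s where s: "{\<xi>, s} \<in># M" "s \<in> B"
    proof -
      obtain e where e: "e \<in># M" "\<xi> \<in> e" by (rule mdeg_pos_edge[of M \<xi>]) (use \<xi> in simp)
      then have eG: "e \<in> edges G" using sub by blast
      show ?thesis
      proof (cases rule: spider_edge[OF G u eG])
        case (1 y) then show ?thesis using that[of y] e notB by (auto simp: B_def)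
      next
        case (2 y z) then show ?thesis using that[of y] e notB by (auto simp: B_def insert_commute)
      qed
    qed
    have sE: "{\<xi>, s} \<in> edges G" using s sub by blast
    have su: "{s, u} \<in> edges G" using s(2) ed(4) by (simp add: B_def)
    have used: "{u, y} \<in># M" if y: "y \<in> B" "{y, \<rho>} \<in> edges G" "\<rho> \<noteq> u" for y
    proof (rule ccontr)
      assume "{u, y} \<notin># M"
      then have "mdeg M y \<le> mdeg M \<rho>" using le_leaf[OF sub y] by simp
      also have "\<dots> < mdeg M' \<rho>" by (rule \<rho>)
      also have "\<dots> \<le> mdeg M' y" by (rule leaf_le[OF sub' y])
      finally show False using True sat y(1) by simp
    qed
    show ?thesis
    proof (cases rule: spider_verts[OF G u \<rho>V])
      case 1
      then show ?thesis
        using exchange_two_walk[where c = c, OF M \<rho>c s(1)] su ed(1)[OF sE] ed(1)[OF su] by simp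
    next
      case 2
      then show ?thesis using notB by (simp add: B_def)
    next
      case (3 y)
      have yB: "y \<in> B" using 3 by (simp add: B_def)
      have y: "{u, y} \<in># M" by (rule used[OF yB 3(2,3)])
      show ?thesis
      proof (cases "\<xi> = u")
        case True
        then show ?thesis
          using exchange_two_walk[where c = c, OF M \<rho>c _ 3(2)] y ed(1)[OF 3(1)] ed(1)[OF 3(2)] by simp
      next
        case False
        have "s \<noteq> y" using spider_atD(3)[OF u 3(1,2), of \<xi>] ed(4)[OF sE] ne False 3(3) by blast
        moreover have "\<xi> \<noteq> y" "s \<noteq> \<rho>" using notB yB s(2) by auto
        ultimately have "distinct [\<xi>, s, u, y, \<rho>]"
          using False ne 3(3) ed(1)[OF sE] ed(1)[OF su] ed(1)[OF 3(1)] ed(1)[OF 3(2)] by auto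
        then show ?thesis by (rule exchange_four_walk[OF M \<rho>c s(1) su y 3(2)])
      qed
    qed
  next
    case False
    then obtain y0 where y0: "y0 \<in> B" "mdeg M y0 < c y0"
      using max_b_matchingD(2)[OF M] BV by (metis le_neq_implies_less subsetD)
    have uV: "u \<in> verts G" by (rule spider_atD(1)[OF u])
    have usat: "mdeg M u = c u"
      using max_b_matching_no_augment[OF M, of u y0] y0 max_b_matchingD(2)[OF M uV] by (simp add: B_def)
    \<comment> \<open>Otherwise \<open>y\<close> could be rematched to \<open>l\<close>, which frees a unit at the centre for \<open>y0\<close>.\<close>
    have unsat: "mdeg M y = c y \<and> {u, y} \<notin># M"
      if y: "y \<in> B" "{y, l} \<in> edges G" "l \<noteq> u" "mdeg M l < c l" for y l
    proof
      show ysat: "mdeg M y = c y"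
        using max_b_matching_no_augment[OF M y(2)] max_b_matchingD(2)[OF M, of y] y(1,4) BV by auto
      show "{u, y} \<notin># M"
      proof
        assume "{u, y} \<in># M"
        then obtain N where N: "max_b_matching G c N"
          "\<And>v. mdeg N v + (if v = u then 1 else 0) = mdeg M v + (if v = l then 1 else 0)"
          using exchange_two_walk[where c = c, OF M y(4) _ y(2)] ed(1)[OF y(2)] uB y(1) by metis
        have "l \<noteq> y0" "u \<noteq> y0" using far[OF y(1-3)] y0 uB by auto
        then have "mdeg N y0 < c y0" "mdeg N u < c u"
          using N(2)[of y0] N(2)[of u] usat y0(2) y(3) by auto
        then show False using max_b_matching_no_augment[OF N(1), of u y0] y0(1) by (simp add: B_def)
      qed
    qed
    define Z where "Z = {l. l \<noteq> u \<and> (\<exists>y\<in>B. {y, l} \<in> edges G)}"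
    define C where "C = insert u ({l\<in>Z. mdeg M l = c l} \<union> {y\<in>B. \<exists>l\<in>Z. {y, l} \<in> edges G \<and> mdeg M l < c l})"
    have ZV: "Z \<subseteq> verts G" using ed(3) by (auto simp: Z_def)
    have ZB: "Z \<inter> B = {}" using far by (auto simp: Z_def)
    have CV: "C \<subseteq> verts G" using uV ZV BV by (auto simp: C_def)
    have finC: "finite C" using finV CV by (rule finite_subset[rotated])
    have leafC: "l \<in> C \<longleftrightarrow> mdeg M l = c l" if "l \<in> Z" for l
      using that ZB by (auto simp: C_def Z_def)
    have lsat: "mdeg M l < c l \<longleftrightarrow> mdeg M l \<noteq> c l" if "l \<in> Z" for l
      using max_b_matchingD(2)[OF M, of l] that ZV by auto
    have inC: "y \<in> C \<longleftrightarrow> l \<notin> C" if y: "y \<in> B" "{y, l} \<in> edges G" "l \<noteq> u" for y l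
    proof -
      have l: "l \<in> Z" using y by (auto simp: Z_def)
      have "y \<in> C \<longleftrightarrow> (\<exists>l\<in>Z. {y, l} \<in> edges G \<and> mdeg M l < c l)" using y(1) uB ZB by (auto simp: C_def)
      also have "\<dots> \<longleftrightarrow> mdeg M l < c l"
      proof
        assume "\<exists>l\<in>Z. {y, l} \<in> edges G \<and> mdeg M l < c l"
        then obtain l' where l': "l' \<in> Z" "{y, l'} \<in> edges G" "mdeg M l' < c l'" by blast
        then have "l' = l" using spider_atD(3)[OF u, of y l' l] y by (simp add: B_def Z_def)
        then show "mdeg M l < c l" using l'(3) by simp
      qed (use l y in blast)
      finally show ?thesis using leafC[OF l] lsat[OF l] by simp
    qed
    have edge1: "card ({y, l} \<inter> C) = 1" if y: "y \<in> B" "{y, l} \<in> edges G" "l \<noteq> u" for y l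
    proof -
      have "{y, l} \<inter> C = {y} \<or> {y, l} \<inter> C = {l}" using inC[OF y] by auto
      then show ?thesis by auto
    qed
    have cover: "e \<inter> C \<noteq> {}" if e: "e \<in> edges G" for e
    proof (cases rule: spider_edge[OF G u e])
      case (1 y) then show ?thesis by (auto simp: C_def)
    next
      case (2 y z)
      then have "card (e \<inter> C) = 1" using edge1[of y z] by (simp add: B_def)
      then show ?thesis by (metis card.empty zero_neq_one)
    qed
    have "card (e \<inter> C) = 1" if e: "e \<in># M" for e
    proof -
      have eG: "e \<in> edges G" using e sub by blast
      show ?thesis
      proof (cases rule: spider_edge[OF G u eG])
        case (1 y)
        have yB: "y \<in> B" using 1(1) by (simp add: B_def)
        have "y \<notin> C"
        proof
          assume "y \<in> C"
          then obtain l where "l \<in> Z" "{y, l} \<in> edges G" "mdeg M l < c l"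
            using yB uB ZB by (auto simp: C_def)
          then show False using unsat[OF yB] 1(2) e by (auto simp: Z_def)
        qed
        then have "e \<inter> C = {u}" using 1 by (auto simp: C_def)
        then show ?thesis by simp
      next
        case (2 y z) then show ?thesis using edge1[of y z] by (simp add: B_def)
      qed
    qed
    then have "size M = (\<Sum>e\<in>#M. card (e \<inter> C))"
      by (subst size_eq_sum_mset) (intro arg_cong[where f = sum_mset] image_mset_cong, simp)
    also have "\<dots> = (\<Sum>v\<in>C. mdeg M v)" by (rule sum_mdeg[OF finC, symmetric])
    also have "\<dots> = (\<Sum>v\<in>C. c v)"
      using usat unsat by (intro sum.cong) (auto simp: C_def Z_def)
    finally have sizeM: "size M = (\<Sum>v\<in>C. c v)" .
    have tight: "mdeg K v = c v" if "max_b_matching G c K" "v \<in> C" for K v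
      by (rule cover_tight(1)[OF finC CV _ max_b_matchingD(3)[OF that(1)] _ that(2)])
        (use cover max_b_matching_size_eq[OF M] that(1) sizeM in auto)
    have tight2: "card (e \<inter> C) = 1" if "max_b_matching G c K" "e \<in># K" for K e
      by (rule cover_tight(2)[OF finC CV _ max_b_matchingD(3)[OF that(1)] _ that(2)])
        (use cover max_b_matching_size_eq[OF M] that(1) sizeM in auto)
    \<comment> \<open>Complementary slackness determines the degree of a vertex of distance two in every maximum matching.\<close>
    have leaf_deg: "mdeg K l = (if l \<in> C then c l else c y)"
      if K: "max_b_matching G c K" and y: "y \<in> B" "{y, l} \<in> edges G" "l \<noteq> u" for K y l
    proof (cases "l \<in> C")
      case False
      then have yC: "y \<in> C" using inC[OF y] by simp
      have "{u, y} \<inter> C = {u, y}" using yC by (auto simp: C_def)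
      moreover have "u \<noteq> y" using uB y(1) by auto
      ultimately have "card ({u, y} \<inter> C) = 2" by simp
      then have "{u, y} \<notin># K" using tight2[OF K, of "{u, y}"] by auto
      then have "mdeg K y = mdeg K l"
        using leaf_le[OF max_b_matchingD(1)[OF K] y] le_leaf[OF max_b_matchingD(1)[OF K] y] by simp
      then show ?thesis using tight[OF K yC] False by simp
    qed (use tight[OF K] in simp)
    have inB: "v \<in> B" if v: "v \<in> verts G" and that: "mdeg M v \<noteq> mdeg M' v" for v
    proof (cases rule: spider_verts[OF G u v])
      case 1 then show ?thesis using that tight[OF M, of u] tight[OF M', of u] by (simp add: C_def)
    next
      case 2 then show ?thesis by (simp add: B_def)
    next
      case (3 y) then show ?thesis using leaf_deg[OF M, of y v] leaf_deg[OF M', of y v] that by (simp add: B_def)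
    qed
    have B: "\<xi> \<in> B" "\<rho> \<in> B" using inB[OF \<xi>V] inB[OF \<rho>V] \<xi> \<rho> by auto
    have \<xi>u: "{\<xi>, u} \<in># M"
    proof (rule ccontr)
      assume no: "{\<xi>, u} \<notin># M"
      obtain e where e: "e \<in># M" "\<xi> \<in> e" by (rule mdeg_pos_edge[of M \<xi>]) (use \<xi> in simp)
      obtain l where l: "e = {\<xi>, l}" "{\<xi>, l} \<in> edges G"
        by (rule edge_other_end[OF simple _ e(2)]) (use e sub in blast)
      have lu: "l \<noteq> u" using no e l by auto
      have "mdeg M \<xi> \<le> mdeg M l" using le_leaf[OF sub B(1) l(2) lu] no by (simp add: insert_commute)
      also have "\<dots> = mdeg M' l" using leaf_deg[OF M B(1) l(2) lu] leaf_deg[OF M' B(1) l(2) lu] by simp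
      also have "\<dots> \<le> mdeg M' \<xi>" by (rule leaf_le[OF sub' B(1) l(2) lu])
      finally show False using \<xi> by simp
    qed
    have "{u, \<rho>} \<in> edges G" "\<xi> \<noteq> u" "u \<noteq> \<rho>" using B uB by (auto simp: B_def)
    then show ?thesis by (rule exchange_two_walk[OF M \<rho>c \<xi>u])
  qed
qed

section \<open>The path with six vertices\<close>

lemma path6_mdeg:
  assumes d: "distinct [v1, v2, v3, v4, v5, v6]"
    and M: "set_mset M \<subseteq> {{v1, v2}, {v2, v3}, {v3, v4}, {v4, v5}, {v5, v6}}"
  shows "mdeg M v1 = count M {v1, v2}"
    "mdeg M v2 = count M {v1, v2} + count M {v2, v3}"
    "mdeg M v3 = count M {v2, v3} + count M {v3, v4}"
    "mdeg M v4 = count M {v3, v4} + count M {v4, v5}"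
    "mdeg M v5 = count M {v4, v5} + count M {v5, v6}"
    "mdeg M v6 = count M {v5, v6}"
    "size M = count M {v1, v2} + count M {v2, v3} + count M {v3, v4} + count M {v4, v5} + count M {v5, v6}"
  using M
proof (atomize (full), induction M)
  case (add e M)
  then have "e = {v1, v2} \<or> e = {v2, v3} \<or> e = {v3, v4} \<or> e = {v4, v5} \<or> e = {v5, v6}" by auto
  then show ?case using add d by (elim disjE) (auto simp: doubleton_eq_iff)
qed simp

text \<open>The five sums are the capacities of the minimal vertex covers of the path. Matching greedily
  from both ends, that is, the outer edges first and the middle edge last, produces a matching
  whose size is one of them, and by weak duality this is the maximum.\<close>
lemma path6_max_size:
  assumes d: "distinct [v1, v2, v3, v4, v5, v6]"
    and E: "edges G = {{v1, v2}, {v2, v3}, {v3, v4}, {v4, v5}, {v5, v6}}"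
    and V: "verts G = {v1, v2, v3, v4, v5, v6}"
    and M: "max_b_matching G c M"
  shows "size M = c v2 + c v4 + c v6 \<or> size M = c v2 + c v4 + c v5 \<or> size M = c v2 + c v3 + c v5 \<or>
    size M = c v1 + c v3 + c v5 \<or> size M = c v1 + c v3 + c v4 + c v6"
proof -
  have greedy_step: "\<exists>k. k \<le> a \<and> k \<le> b \<and> (k = a \<or> k = b)" for a b :: nat
    by (intro exI[of _ "min a b"]) auto
  obtain k1 where k1: "k1 \<le> c v1" "k1 \<le> c v2" "k1 = c v1 \<or> k1 = c v2"
    using greedy_step by blast
  obtain k5 where k5: "k5 \<le> c v5" "k5 \<le> c v6" "k5 = c v5 \<or> k5 = c v6"
    using greedy_step by blast
  obtain k2 where "k2 \<le> c v2 - k1" "k2 \<le> c v3" "k2 = c v2 - k1 \<or> k2 = c v3"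
    using greedy_step by blast
  then have k2: "k1 + k2 \<le> c v2" "k2 \<le> c v3" "k1 + k2 = c v2 \<or> k2 = c v3" using k1(2) by auto
  obtain k4 where "k4 \<le> c v5 - k5" "k4 \<le> c v4" "k4 = c v5 - k5 \<or> k4 = c v4"
    using greedy_step by blast
  then have k4: "k4 + k5 \<le> c v5" "k4 \<le> c v4" "k4 + k5 = c v5 \<or> k4 = c v4" using k5(1) by auto
  obtain k3 where "k3 \<le> c v3 - k2" "k3 \<le> c v4 - k4" "k3 = c v3 - k2 \<or> k3 = c v4 - k4"
    using greedy_step by blast
  then have k3: "k2 + k3 \<le> c v3" "k3 + k4 \<le> c v4" "k2 + k3 = c v3 \<or> k3 + k4 = c v4"
    using k2(2) k4(2) by auto
  define N where "N = replicate_mset k1 {v1, v2} + replicate_mset k2 {v2, v3} + replicate_mset k3 {v3, v4}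
    + replicate_mset k4 {v4, v5} + replicate_mset k5 {v5, v6}"
  have "set_mset N \<subseteq> edges G" unfolding N_def E by (auto simp: in_replicate_mset)
  moreover have "mdeg N v \<le> c v" if "v \<in> verts G" for v
  proof -
    have dd: "distinct [v6, v5, v4, v3, v2, v1]" using d by auto
    have "mdeg N v1 = k1" "mdeg N v2 = k1 + k2" "mdeg N v3 = k2 + k3" "mdeg N v4 = k3 + k4"
      "mdeg N v5 = k4 + k5" "mdeg N v6 = k5" using dd d by (simp_all add: N_def)
    then show ?thesis using that V k1(1) k2(1) k3(1,2) k4(1) k5(2) by auto
  qed
  ultimately have "b_matching G c N" by (simp add: b_matching_def)
  then have "size N \<le> size M" by (rule max_b_matchingD(4)[OF M])
  moreover have "size N = k1 + k2 + k3 + k4 + k5" by (simp add: N_def)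
  ultimately have ge: "k1 + k2 + k3 + k4 + k5 \<le> size M" by simp
  have greedy: "c v2 + c v4 + c v6 \<le> k1 + k2 + k3 + k4 + k5 \<or> c v2 + c v4 + c v5 \<le> k1 + k2 + k3 + k4 + k5 \<or>
    c v2 + c v3 + c v5 \<le> k1 + k2 + k3 + k4 + k5 \<or> c v1 + c v3 + c v5 \<le> k1 + k2 + k3 + k4 + k5 \<or>
    c v1 + c v3 + c v4 + c v6 \<le> k1 + k2 + k3 + k4 + k5"
    using k1(3) k2(3) k3(3) k4(3) k5(3)
    by (elim disjE) (use k1(1,2) k2(1,2) k3(1,2) k4(1,2) k5(1,2) in linarith)+
  note deg = path6_mdeg[OF d max_b_matchingD(1)[OF M, unfolded E]]
  have "mdeg M v \<le> c v" if "v \<in> {v1, v2, v3, v4, v5, v6}" for v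
    using max_b_matchingD(2)[OF M, of v] that V by simp
  then have "mdeg M v1 \<le> c v1" "mdeg M v2 \<le> c v2" "mdeg M v3 \<le> c v3"
    "mdeg M v4 \<le> c v4" "mdeg M v5 \<le> c v5" "mdeg M v6 \<le> c v6" by blast+
  then have "size M \<le> c v2 + c v4 + c v6" "size M \<le> c v2 + c v4 + c v5" "size M \<le> c v2 + c v3 + c v5"
    "size M \<le> c v1 + c v3 + c v5" "size M \<le> c v1 + c v3 + c v4 + c v6"
    unfolding deg by linarith+
  moreover have "size M = C" if "C \<le> k1 + k2 + k3 + k4 + k5" "size M \<le> C" for C
    using ge that by simp
  ultimately show ?thesis using greedy by blast
qed

text \<open>Complementary slackness for each of the five covers, spelled out. In the first two cases the
  degrees of even index are determined, in the other ones those of odd index; the sum in the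
  last case arises because the edge between \<open>v3\<close> and \<open>v4\<close> is not used.\<close>
lemma path6_const:
  assumes d: "distinct [v1, v2, v3, v4, v5, v6]"
    and E: "edges G = {{v1, v2}, {v2, v3}, {v3, v4}, {v4, v5}, {v5, v6}}"
    and V: "verts G = {v1, v2, v3, v4, v5, v6}"
    and M: "max_b_matching G c M"
  shows "size M = c v2 + c v4 + c v6 \<Longrightarrow> mdeg M v2 = c v2 \<and> mdeg M v4 = c v4 \<and> mdeg M v6 = c v6"
    "size M = c v2 + c v4 + c v5 \<Longrightarrow> mdeg M v2 = c v2 \<and> mdeg M v4 = c v4 \<and> mdeg M v5 = c v5 \<and> mdeg M v6 = c v5"
    "size M = c v2 + c v3 + c v5 \<Longrightarrow> mdeg M v1 = c v2 \<and> mdeg M v3 = c v3 \<and> mdeg M v5 = c v5"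
    "size M = c v1 + c v3 + c v5 \<Longrightarrow> mdeg M v1 = c v1 \<and> mdeg M v3 = c v3 \<and> mdeg M v5 = c v5"
    "size M = c v1 + c v3 + c v4 + c v6 \<Longrightarrow> mdeg M v1 = c v1 \<and> mdeg M v3 = c v3 \<and> mdeg M v5 = c v4 + c v6"
proof -
  note deg = path6_mdeg[OF d max_b_matchingD(1)[OF M, unfolded E]]
  have le: "mdeg M v1 \<le> c v1" "mdeg M v2 \<le> c v2" "mdeg M v3 \<le> c v3"
    "mdeg M v4 \<le> c v4" "mdeg M v5 \<le> c v5" "mdeg M v6 \<le> c v6"
    using max_b_matchingD(2)[OF M] V by auto
  show "size M = c v2 + c v4 + c v6 \<Longrightarrow> mdeg M v2 = c v2 \<and> mdeg M v4 = c v4 \<and> mdeg M v6 = c v6"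
    "size M = c v2 + c v4 + c v5 \<Longrightarrow> mdeg M v2 = c v2 \<and> mdeg M v4 = c v4 \<and> mdeg M v5 = c v5 \<and> mdeg M v6 = c v5"
    "size M = c v2 + c v3 + c v5 \<Longrightarrow> mdeg M v1 = c v2 \<and> mdeg M v3 = c v3 \<and> mdeg M v5 = c v5"
    "size M = c v1 + c v3 + c v5 \<Longrightarrow> mdeg M v1 = c v1 \<and> mdeg M v3 = c v3 \<and> mdeg M v5 = c v5"
    "size M = c v1 + c v3 + c v4 + c v6 \<Longrightarrow> mdeg M v1 = c v1 \<and> mdeg M v3 = c v3 \<and> mdeg M v5 = c v4 + c v6"
    using le unfolding deg by (intro conjI; linarith)+
qed

text \<open>Odd indices change only if one of the first two covers is tight. Then \<open>v2\<close> and
  \<open>v4\<close> are saturated, and an edge that has to be removed on the way from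
  \<open>\<xi>\<close> to \<open>\<rho>\<close> is present because \<open>M'\<close> has a
  larger (or smaller) degree at the end in question.\<close>
lemma path6_exchange_odd:
  assumes d: "distinct [v1, v2, v3, v4, v5, v6]"
    and E: "edges G = {{v1, v2}, {v2, v3}, {v3, v4}, {v4, v5}, {v5, v6}}"
    and V: "verts G = {v1, v2, v3, v4, v5, v6}"
    and M: "max_b_matching G c M" and M': "max_b_matching G c M'"
    and \<xi>: "mdeg M' \<xi> < mdeg M \<xi>" and \<rho>: "mdeg M \<rho> < mdeg M' \<rho>"
    and odd: "\<xi> \<in> {v1, v3, v5}" "\<rho> \<in> {v1, v3, v5}"
  shows "\<exists>N. max_b_matching G c N \<and>
      (\<forall>v. mdeg N v + (if v = \<xi> then 1 else 0) = mdeg M v + (if v = \<rho> then 1 else 0))"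
proof -
  note deg = path6_mdeg[OF d max_b_matchingD(1)[OF M, unfolded E]]
  note deg' = path6_mdeg[OF d max_b_matchingD(1)[OF M', unfolded E]]
  note size = path6_max_size[OF d E V M]
  have eq: "size M' = size M" using max_b_matching_size_eq[OF M] M' by simp
  have le': "mdeg M' v1 \<le> c v1" "mdeg M' v2 \<le> c v2" "mdeg M' v3 \<le> c v3"
    "mdeg M' v4 \<le> c v4" "mdeg M' v5 \<le> c v5" "mdeg M' v6 \<le> c v6"
    using max_b_matchingD(2)[OF M'] V by auto
  have \<rho>c: "mdeg M \<rho> < c \<rho>" using \<rho> le' odd by auto
  have edge: "{v1, v2} \<in> edges G" "{v2, v1} \<in> edges G" "{v2, v3} \<in> edges G" "{v3, v2} \<in> edges G"
     "{v3, v4} \<in> edges G" "{v4, v3} \<in> edges G" "{v4, v5} \<in> edges G" "{v5, v4} \<in> edges G"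
    by (auto simp: E insert_commute)
  have e12: "{v1, v2} \<in># M" if "mdeg M' v1 < mdeg M v1" using that deg(1) by (simp flip: count_greater_zero_iff)
  have "mdeg M v1 = mdeg M' v1 \<and> mdeg M v3 = mdeg M' v3 \<and> mdeg M v5 = mdeg M' v5
     \<or> mdeg M v2 = c v2 \<and> mdeg M v4 = c v4 \<and> (mdeg M v6 = c v6 \<and> mdeg M' v6 = c v6 \<or> mdeg M v5 = mdeg M' v5)"
    using size path6_const[OF d E V M] path6_const[OF d E V M'] unfolding eq by (elim disjE) simp_all
  then have sat: "mdeg M v2 = c v2" "mdeg M v4 = c v4"
      "mdeg M v5 \<noteq> mdeg M' v5 \<Longrightarrow> mdeg M v6 = c v6 \<and> mdeg M' v6 = c v6"
    using \<xi> odd(1) by auto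
  have e32: "{v3, v2} \<in># M" if "mdeg M v1 < mdeg M' v1"
  proof -
    have "0 < count M {v2, v3}" using that sat(1) le'(2) unfolding deg deg' by linarith
    then show ?thesis by (simp add: insert_commute)
  qed
  have e34: "{v3, v4} \<in># M" if "mdeg M v5 < mdeg M' v5"
  proof -
    have "mdeg M v6 = c v6" "mdeg M' v6 = c v6" using sat(3) that by simp_all
    then have "0 < count M {v3, v4}" using that sat(2) le'(4) unfolding deg deg' by linarith
    then show ?thesis by simp
  qed
  have e54: "{v5, v4} \<in># M" if "mdeg M' v5 < mdeg M v5"
  proof -
    have "mdeg M v6 = c v6" "mdeg M' v6 = c v6" using sat(3) that by simp_all
    then have "0 < count M {v4, v5}" using that unfolding deg deg' by linarith
    then show ?thesis by (simp add: insert_commute)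
  qed
  note two = exchange_two_walk[where c = c, OF M \<rho>c] and four = exchange_four_walk[where c = c, OF M \<rho>c]
  consider "\<xi> = v1" "\<rho> = v3" | "\<xi> = v1" "\<rho> = v5" | "\<xi> = v3" "\<rho> = v1" | "\<xi> = v3" "\<rho> = v5"
    | "\<xi> = v5" "\<rho> = v1" | "\<xi> = v5" "\<rho> = v3"
    using odd \<xi> \<rho> by auto
  then show ?thesis
  proof cases
    case 1
    then have "{\<xi>, v2} \<in># M" "{v2, \<rho>} \<in> edges G" "\<xi> \<noteq> v2" "v2 \<noteq> \<rho>" using e12 \<xi> edge d by auto
    then show ?thesis by (rule two)
  next
    case 2
    then have "{\<xi>, v2} \<in># M" "{v2, v3} \<in> edges G" "{v3, v4} \<in># M" "{v4, \<rho>} \<in> edges G"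
      "distinct [\<xi>, v2, v3, v4, \<rho>]" using e12 e34 \<xi> \<rho> edge d by auto
    then show ?thesis by (rule four)
  next
    case 3
    then have "{\<xi>, v2} \<in># M" "{v2, \<rho>} \<in> edges G" "\<xi> \<noteq> v2" "v2 \<noteq> \<rho>" using e32 \<rho> edge d by auto
    then show ?thesis by (rule two)
  next
    case 4
    then have "{\<xi>, v4} \<in># M" "{v4, \<rho>} \<in> edges G" "\<xi> \<noteq> v4" "v4 \<noteq> \<rho>" using e34 \<rho> edge d by auto
    then show ?thesis by (rule two)
  next
    case 5
    then have "{\<xi>, v4} \<in># M" "{v4, v3} \<in> edges G" "{v3, v2} \<in># M" "{v2, \<rho>} \<in> edges G"
      "distinct [\<xi>, v4, v3, v2, \<rho>]" using e54 e32 \<xi> \<rho> edge d by auto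
    then show ?thesis by (rule four)
  next
    case 6
    then have "{\<xi>, v4} \<in># M" "{v4, \<rho>} \<in> edges G" "\<xi> \<noteq> v4" "v4 \<noteq> \<rho>" using e54 \<xi> edge d by auto
    then show ?thesis by (rule two)
  qed
qed

text \<open>The degrees of one parity are constant, and reversing the path interchanges the parities.\<close>
lemma path6_exchange:
  assumes d: "distinct [v1, v2, v3, v4, v5, v6]"
    and E: "edges G = {{v1, v2}, {v2, v3}, {v3, v4}, {v4, v5}, {v5, v6}}"
    and V: "verts G = {v1, v2, v3, v4, v5, v6}" and simple: "simple_graph G"
  shows "exchange_property G c"
  unfolding exchange_property_def
proof (intro allI impI)
  fix M M' \<xi> \<rho>
  assume M: "max_b_matching G c M" and M': "max_b_matching G c M'"
    and \<xi>: "mdeg M' \<xi> < mdeg M \<xi>" and \<rho>: "mdeg M \<rho> < mdeg M' \<rho>"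
  note size = path6_max_size[OF d E V M]
  have eq: "size M' = size M" using max_b_matching_size_eq[OF M] M' by simp
  have const: "(mdeg M v1 = mdeg M' v1 \<and> mdeg M v3 = mdeg M' v3 \<and> mdeg M v5 = mdeg M' v5) \<or>
     (mdeg M v2 = mdeg M' v2 \<and> mdeg M v4 = mdeg M' v4 \<and> mdeg M v6 = mdeg M' v6)"
    using size path6_const[OF d E V M] path6_const[OF d E V M'] unfolding eq by (elim disjE) simp_all
  have \<xi>V: "\<xi> \<in> verts G" using \<xi> mdeg_outside[OF simple max_b_matchingD(1)[OF M]] by (metis not_less_zero)
  have \<rho>V: "\<rho> \<in> verts G" using \<rho> mdeg_outside[OF simple max_b_matchingD(1)[OF M']] by (metis not_less_zero)
  have "\<xi> \<in> {v1, v3, v5} \<and> \<rho> \<in> {v1, v3, v5} \<or> \<xi> \<in> {v6, v4, v2} \<and> \<rho> \<in> {v6, v4, v2}"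
    using \<xi>V \<rho>V \<xi> \<rho> const unfolding V by auto
  then show "\<exists>N. max_b_matching G c N \<and>
      (\<forall>v. mdeg N v + (if v = \<xi> then 1 else 0) = mdeg M v + (if v = \<rho> then 1 else 0))"
  proof
    assume "\<xi> \<in> {v1, v3, v5} \<and> \<rho> \<in> {v1, v3, v5}"
    then show ?thesis using path6_exchange_odd[OF d E V M M' \<xi> \<rho>] by blast
  next
    assume odd: "\<xi> \<in> {v6, v4, v2} \<and> \<rho> \<in> {v6, v4, v2}"
    have "distinct [v6, v5, v4, v3, v2, v1]" using d by auto
    moreover have "edges G = {{v6, v5}, {v5, v4}, {v4, v3}, {v3, v2}, {v2, v1}}"
      unfolding E by (auto simp: insert_commute)
    moreover have "verts G = {v6, v5, v4, v3, v2, v1}" unfolding V by auto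
    ultimately show ?thesis using path6_exchange_odd[OF _ _ _ M M' \<xi> \<rho>] odd by blast
  qed
qed

section \<open>Recognizing the two families up to isomorphism\<close>

lemma graph_iso_sym:
  assumes "graph_iso G H" "\<And>e. e \<in> edges G \<Longrightarrow> e \<subseteq> verts G"
  shows "graph_iso H G"
proof -
  obtain f where f: "bij_betw f (verts G) (verts H)" "(\<lambda>e. f ` e) ` edges G = edges H"
    using assms(1) by (auto simp: graph_iso_def)
  let ?g = "inv_into (verts G) f"
  have "?g ` (f ` e) = e" if "e \<in> edges G" for e
    using f(1) assms(2)[OF that] by (intro inv_into_image_cancel) (auto simp: bij_betw_def)
  then have "(\<lambda>e. ?g ` e) ` edges H = edges G"
    unfolding f(2)[symmetric] image_image by simp
  then show ?thesis unfolding graph_iso_def using bij_betw_inv_into[OF f(1)] by blast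
qed

lemma exchange_of_iso_path6:
  assumes simple: "simple_graph G" and iso: "graph_iso G (path_graph 6)"
  shows "exchange_property G c"
proof -
  obtain g where g: "bij_betw g {1..6::nat} (verts G)"
    "edges G = (\<lambda>e. g ` e) ` {{i, i + 1} |i. 1 \<le> i \<and> i < 6}"
    using graph_iso_sym[OF iso] simple by (auto simp: graph_iso_def path_graph_def simple_graph_def)
  have six: "{1..6::nat} = {1, 2, 3, 4, 5, 6}" by auto
  have "{{i, i + 1} |i::nat. 1 \<le> i \<and> i < 6} = (\<lambda>i. {i, i + 1}) ` {1..<6}" by auto
  also have "{1..<6::nat} = {1, 2, 3, 4, 5}" by auto
  finally have E: "edges G = {{g 1, g 2}, {g 2, g 3}, {g 3, g 4}, {g 4, g 5}, {g 5, g 6}}"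
    using g(2) by (simp add: eval_nat_numeral)
  have V: "verts G = {g 1, g 2, g 3, g 4, g 5, g 6}"
    using g(1) unfolding six bij_betw_def by auto
  have "distinct [g 1, g 2, g 3, g 4, g 5, g 6]"
    using g(1) unfolding six bij_betw_def inj_on_def by auto
  then show ?thesis using path6_exchange[OF _ E V simple] by blast
qed

lemma attach_pendants_star:
  assumes "L \<subseteq> leaves (star_graph m)"
  shows "verts (attach_pendants (star_graph m) L) = Inl ` {1..m + 1} \<union> Inr ` L"
    "edges (attach_pendants (star_graph m) L) =
       {{Inl i, Inl (m + 1)} |i. 1 \<le> i \<and> i \<le> m} \<union> {{Inl i, Inr i} |i. i \<in> L}"
    "L \<subseteq> {1..m + 1}"
proof -
  show "verts (attach_pendants (star_graph m) L) = Inl ` {1..m + 1} \<union> Inr ` L"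
    by (simp add: attach_pendants_def star_graph_def)
  have "(\<lambda>e. (Inl :: nat \<Rightarrow> nat + nat) ` e) ` {{i, m + 1} |i. 1 \<le> i \<and> i \<le> m} = {Inl ` {i, m + 1} |i. 1 \<le> i \<and> i \<le> m}"
    by blast
  then show "edges (attach_pendants (star_graph m) L) =
       {{Inl i, Inl (m + 1)} |i. 1 \<le> i \<and> i \<le> m} \<union> {{Inl i, Inr i} |i. i \<in> L}"
    by (simp add: attach_pendants_def star_graph_def)
  show "L \<subseteq> {1..m + 1}" using assms by (auto simp: leaves_def star_graph_def)
qed

text \<open>This includes the star with a single edge, both ends of which are leaves: a pendant edge at
  the centre \<open>m + 1\<close> then is an additional leg of length one.\<close>
lemma spider_at_attach_pendants:
  assumes L: "L \<subseteq> leaves (star_graph m)"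
  shows "spider_at (attach_pendants (star_graph m) L) (Inl (m + 1))"
proof -
  let ?H = "attach_pendants (star_graph m) L" and ?u = "Inl (m + 1) :: nat + nat"
  have adj: "{x, y} \<in> edges ?H \<longleftrightarrow>
      (\<exists>i. 1 \<le> i \<and> i \<le> m \<and> (x = Inl i \<and> y = ?u \<or> y = Inl i \<and> x = ?u)) \<or>
      (\<exists>i\<in>L. x = Inl i \<and> y = Inr i \<or> y = Inl i \<and> x = Inr i)" for x y
    unfolding attach_pendants_star[OF L] by (auto simp: doubleton_eq_iff)
  have u: "?u \<in> verts ?H" unfolding attach_pendants_star[OF L] by simp
  show ?thesis
    unfolding spider_at_def using u by (auto simp: adj)
qed

text \<open>Adjacency is reflected by an isomorphism, so neighbours of images can be pulled back.\<close>
lemma spider_at_iso: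
  assumes iso: "graph_iso H G" and H: "\<And>e. e \<in> edges H \<Longrightarrow> e \<subseteq> verts H" and w: "spider_at H w"
  shows "\<exists>u. spider_at G u"
proof -
  obtain g where g: "bij_betw g (verts H) (verts G)" "edges G = (\<lambda>e. g ` e) ` edges H"
    using iso by (auto simp: graph_iso_def)
  have inj: "g x = g y \<longleftrightarrow> x = y" if "x \<in> verts H" "y \<in> verts H" for x y
    using g(1) that by (auto simp: bij_betw_def inj_on_def)
  have wV: "w \<in> verts H" by (rule spider_atD(1)[OF w])
  have nbr: "\<exists>y'\<in>verts H. y = g y' \<and> {x, y'} \<in> edges H" if x: "x \<in> verts H" and e: "{g x, y} \<in> edges G" for x y
  proof -
    obtain e' where e': "e' \<in> edges H" "{g x, y} = g ` e'" using e g(2) by blast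
    have sub: "e' \<subseteq> verts H" by (rule H[OF e'(1)])
    then have "x \<in> e'" using e'(2) inj[OF x] by (metis imageE insertI1 subsetD)
    obtain y' where y': "y' \<in> e'" "y = g y'" using e'(2) by blast
    show ?thesis
    proof (cases "y' = x")
      case False
      have "z = x \<or> z = y'" if "z \<in> e'" for z
      proof -
        have "g z = g x \<or> g z = y" using e'(2) that by blast
        then show ?thesis using inj sub that x y' by blast
      qed
      then have "e' = {x, y'}" using \<open>x \<in> e'\<close> y'(1) by blast
      then show ?thesis using e'(1) y' sub by blast
    next
      case True
      have "z = x" if "z \<in> e'" for z
      proof -
        have "g z = g x" using e'(2) that y' True by auto
        then show ?thesis using inj sub that x by blast
      qed
      then have "e' = {x, y'}" using \<open>x \<in> e'\<close> True by blast
      then show ?thesis using e'(1) y' sub by blast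
    qed
  qed
  have "spider_at G (g w)"
    unfolding spider_at_def
  proof (intro conjI allI impI)
    show "g w \<in> verts G" using g(1) wV by (auto simp: bij_betw_def)
  next
    fix y z v assume y: "{g w, y} \<in> edges G" and z: "{y, z} \<in> edges G" "z \<noteq> g w" and v: "{z, v} \<in> edges G"
    obtain y' where y': "y' \<in> verts H" "y = g y'" "{w, y'} \<in> edges H" using nbr[OF wV y] by blast
    obtain z' where z': "z' \<in> verts H" "z = g z'" "{y', z'} \<in> edges H" using nbr[OF y'(1)] z(1) y'(2) by blast
    obtain v' where v': "v' \<in> verts H" "v = g v'" "{z', v'} \<in> edges H" using nbr[OF z'(1)] v z'(2) by blast
    have "v' = y'" using spider_atD(2)[OF w y'(3) z'(3) _ v'(3)] z(2) z'(2) by blast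
    then show "v = y" using v' y' by simp
  next
    fix y z v assume y: "{g w, y} \<in> edges G" and z: "{y, z} \<in> edges G" "{y, v} \<in> edges G" "z \<noteq> g w" "v \<noteq> g w"
    obtain y' where y': "y' \<in> verts H" "y = g y'" "{w, y'} \<in> edges H" using nbr[OF wV y] by blast
    obtain z' where z': "z' \<in> verts H" "z = g z'" "{y', z'} \<in> edges H" using nbr[OF y'(1)] z(1) y'(2) by blast
    obtain v' where v': "v' \<in> verts H" "v = g v'" "{y', v'} \<in> edges H" using nbr[OF y'(1)] z(2) y'(2) by blast
    have "z' = v'" using spider_atD(3)[OF w y'(3) z'(3) v'(3)] z z'(2) v'(2) by blast
    then show "z = v" using z' v' by simp
  qed
  then show ?thesis by blast
qed

lemma star_leaf: "1 \<le> i \<Longrightarrow> i \<le> m \<Longrightarrow> i \<in> leaves (star_graph m)"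
proof -
  assume i: "1 \<le> i" "i \<le> m"
  then have "{e \<in> edges (star_graph m). i \<in> e} = {{i, m + 1}}" by (auto simp: star_graph_def)
  then show ?thesis using i by (simp add: leaves_def degree_def) (simp add: star_graph_def)
qed

text \<open>The legs are numbered by \<open>h\<close>, and a vertex of distance two goes to the pendant
  vertex of its parent.\<close>
lemma spider_iso_attach_pendants:
  assumes G: "tree G" and u: "spider_at G u"
  shows "\<exists>m L. m \<ge> 1 \<and> L \<subseteq> leaves (star_graph m) \<and> graph_iso G (attach_pendants (star_graph m) L)"
proof -
  note simple = tree_simple[OF G]
  note ed = edge_facts[OF simple]
  have finV: "finite (verts G)" using simple by (simp add: simple_graph_def)
  define B where "B = {y. {u, y} \<in> edges G}"
  have BV: "B \<subseteq> verts G" and uB: "u \<notin> B" using ed(3) ed(1)[of u u] by (auto simp: B_def)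
  have finB: "finite B" using finV BV by (rule finite_subset[rotated])
  define m where "m = card B"
  obtain h where h: "bij_betw h B {1..m}" using bij_betw_iff_card[OF finB, of "{1..m}"] by (auto simp: m_def)
  have hinj: "h x = h y \<longleftrightarrow> x = y" if "x \<in> B" "y \<in> B" for x y
    using h that by (auto simp: bij_betw_def inj_on_def)
  have hm: "1 \<le> h y" "h y \<le> m" if "y \<in> B" for y using h that by (auto simp: bij_betw_def)
  define Z where "Z = {z. z \<noteq> u \<and> (\<exists>y\<in>B. {y, z} \<in> edges G)}"
  have ZB: "z \<notin> B" if "z \<in> Z" for z
    using that spider_far[OF simple u] by (auto simp: Z_def B_def)
  have V: "verts G = insert u (B \<union> Z)"
  proof
    show "verts G \<subseteq> insert u (B \<union> Z)"
    proof
      fix v assume v: "v \<in> verts G"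
      show "v \<in> insert u (B \<union> Z)"
        by (cases rule: spider_verts[OF G u v]) (auto simp: B_def Z_def)
    qed
    show "insert u (B \<union> Z) \<subseteq> verts G" using spider_atD(1)[OF u] BV ed(3) by (auto simp: Z_def)
  qed
  define par where "par = (\<lambda>z. SOME y. y \<in> B \<and> {y, z} \<in> edges G)"
  have par: "par z = y" if "y \<in> B" "{y, z} \<in> edges G" "z \<noteq> u" for y z
  proof -
    have "par z \<in> B \<and> {par z, z} \<in> edges G" unfolding par_def
      using that someI[of "\<lambda>y. y \<in> B \<and> {y, z} \<in> edges G" y] by blast
    then show ?thesis using spider_atD(2)[OF u, of y z "par z"] that ed(4) by (simp add: B_def)
  qed
  have parZ: "par z \<in> B" "{par z, z} \<in> edges G" if "z \<in> Z" for z
    using that par by (auto simp: Z_def)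
  have par_inj: "z = z'" if "z \<in> Z" "z' \<in> Z" "par z = par z'" for z z'
    using spider_atD(3)[OF u, of "par z" z z'] parZ[OF that(1)] parZ[OF that(2)] that by (simp add: B_def Z_def)
  define L where "L = (\<lambda>z. h (par z)) ` Z"
  have LS: "L \<subseteq> leaves (star_graph m)"
    using star_leaf hm parZ(1) by (simp add: L_def image_subset_iff)
  define f where "f = (\<lambda>x. if x = u then Inl (m + 1) else if x \<in> B then Inl (h x) else Inr (h (par x)))"
  have fu: "f u = Inl (m + 1)" by (simp add: f_def)
  have fB: "f y = Inl (h y)" if "y \<in> B" for y using that uB by (auto simp: f_def)
  have fZ: "f z = Inr (h (par z))" if "z \<in> Z" for z
  proof -
    have "z \<noteq> u" using that by (simp add: Z_def)
    then show ?thesis using ZB[OF that] by (simp add: f_def)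
  qed
  note H = attach_pendants_star[OF LS]
  have "bij_betw f (verts G) (verts (attach_pendants (star_graph m) L))"
    unfolding bij_betw_def
  proof
    have hn: "h y \<noteq> m + 1" if "y \<in> B" for y using hm[OF that] by simp
    show "inj_on f (verts G)"
    proof (rule inj_onI)
      fix x y assume xy: "x \<in> verts G" "y \<in> verts G" "f x = f y"
      then consider "x = u" "y = u" | "x \<in> B" "y \<in> B" | "x \<in> Z" "y \<in> Z"
        | "x = u" "y \<in> B" | "x \<in> B" "y = u" | "x \<in> Z" "y \<notin> Z" | "x \<notin> Z" "y \<in> Z"
        unfolding V by blast
      then show "x = y"
      proof cases
        case 2 then show ?thesis using xy(3) fB hinj by simp
      next
        case 3 then show ?thesis using xy(3) fZ hinj parZ par_inj by simp
      next
        case 4 then show ?thesis using xy(3) fu fB[of y] hn[of y] by simp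
      next
        case 5 then show ?thesis using xy(3) fu fB[of x] hn[of x] by simp
      next
        case 6 then show ?thesis using xy fu fB[of y] fZ[of x] unfolding V by auto
      next
        case 7 then show ?thesis using xy fu fB[of x] fZ[of y] unfolding V by auto
      qed simp
    qed
    have "f ` verts G = insert (f u) (f ` B \<union> f ` Z)" unfolding V by blast
    also have "f ` B = Inl ` {1..m}"
    proof -
      have "f ` B = (\<lambda>y. Inl (h y)) ` B" by (intro image_cong) (simp_all add: fB)
      also have "\<dots> = Inl ` h ` B" by blast
      finally show ?thesis using h by (simp add: bij_betw_def)
    qed
    also have "f ` Z = Inr ` L" using fZ by (auto simp: L_def image_def)
    finally show "f ` verts G = verts (attach_pendants (star_graph m) L)"
      unfolding H(1) fu by (simp add: atLeastAtMostSuc_conv)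
  qed
  moreover have "(\<lambda>e. f ` e) ` edges G = edges (attach_pendants (star_graph m) L)"
  proof (intro equalityI subsetI)
    fix e' assume "e' \<in> (\<lambda>e. f ` e) ` edges G"
    then obtain e where e: "e \<in> edges G" "e' = f ` e" by blast
    show "e' \<in> edges (attach_pendants (star_graph m) L)"
    proof (cases rule: spider_edge[OF G u e(1)])
      case (1 y)
      then have "e' = {Inl (h y), Inl (m + 1)}" "y \<in> B" using e(2) fu fB[of y] by (auto simp: B_def)
      then show ?thesis unfolding H using hm by blast
    next
      case (2 y z)
      then have z: "z \<in> Z" "y \<in> B" "par z = y" using par by (auto simp: Z_def B_def)
      then have "e' = {Inl (h y), Inr (h y)}" "h y \<in> L" using e(2) 2 fB[of y] fZ[of z] by (auto simp: L_def)
      then show ?thesis unfolding H by blast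
    qed
  next
    fix e' assume "e' \<in> edges (attach_pendants (star_graph m) L)"
    then consider i where "e' = {Inl i, Inl (m + 1)}" "1 \<le> i" "i \<le> m" | i where "e' = {Inl i, Inr i}" "i \<in> L"
      unfolding H by blast
    then show "e' \<in> (\<lambda>e. f ` e) ` edges G"
    proof cases
      case (1 i)
      then have "i \<in> h ` B" using h by (simp add: bij_betw_def)
      then obtain y where y: "y \<in> B" "i = h y" by blast
      then have "e' = f ` {u, y}" using 1 fu fB[of y] by (simp add: insert_commute)
      moreover have "{u, y} \<in> edges G" using y by (simp add: B_def)
      ultimately show ?thesis by blast
    next
      case (2 i)
      then obtain z where z: "z \<in> Z" "i = h (par z)" by (auto simp: L_def)
      then have "e' = f ` {par z, z}" using 2 fB[of "par z"] fZ[of z] parZ by simp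
      then show ?thesis using parZ[OF z(1)] by blast
    qed
  qed
  ultimately have "graph_iso G (attach_pendants (star_graph m) L)" unfolding graph_iso_def by blast
  moreover have "m \<ge> 1"
  proof -
    obtain e where "e \<in> edges G" using spider_atD(1)[OF u] simple by (auto simp: simple_graph_def)
    then have "B \<noteq> {}" by (cases rule: spider_edge[OF G u]) (auto simp: B_def)
    then show ?thesis using finB by (simp add: m_def Suc_le_eq card_gt_0_iff)
  qed
  ultimately show ?thesis using LS by blast
qed

section \<open>The characterization\<close>

theorem theorem4p10:
  fixes G :: "'v ugraph"
  assumes "tree G"
  shows "strong_exchange_graph TYPE('k::field) G \<longleftrightarrow>
           graph_iso G (path_graph 6) \<or>
           (\<exists>m L. m \<ge> 1 \<and> L \<subseteq> leaves (star_graph m) \<and>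
                  graph_iso G (attach_pendants (star_graph m) L))"
proof -
  note simple = tree_simple[OF assms]
  show ?thesis
    unfolding strong_exchange_graph_iff[OF simple]
  proof
    assume "\<forall>c. (\<forall>v\<in>verts G. 0 < c v) \<longrightarrow> exchange_property G c"
    then have "(\<exists>u. spider_at G u) \<or> graph_iso G (path_graph 6)"
      by (intro exchange_imp_spider_or_path[OF assms]) blast
    then show "graph_iso G (path_graph 6) \<or>
           (\<exists>m L. m \<ge> 1 \<and> L \<subseteq> leaves (star_graph m) \<and>
                  graph_iso G (attach_pendants (star_graph m) L))"
      using spider_iso_attach_pendants[OF assms] by blast
  next
    assume "graph_iso G (path_graph 6) \<or>
           (\<exists>m L. m \<ge> 1 \<and> L \<subseteq> leaves (star_graph m) \<and>
                  graph_iso G (attach_pendants (star_graph m) L))"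
    then have "exchange_property G c" for c
    proof
      assume "graph_iso G (path_graph 6)"
      then show ?thesis by (rule exchange_of_iso_path6[OF simple])
    next
      assume "\<exists>m L. m \<ge> 1 \<and> L \<subseteq> leaves (star_graph m) \<and> graph_iso G (attach_pendants (star_graph m) L)"
      then obtain m L where L: "L \<subseteq> leaves (star_graph m)" "graph_iso G (attach_pendants (star_graph m) L)"
        by blast
      have iso: "graph_iso (attach_pendants (star_graph m) L) G"
        by (rule graph_iso_sym[OF L(2)]) (use simple in \<open>simp add: simple_graph_def\<close>)
      have sub: "e \<subseteq> verts (attach_pendants (star_graph m) L)"
        if e: "e \<in> edges (attach_pendants (star_graph m) L)" for e
      proof -
        note H = attach_pendants_star[OF L(1)]
        consider i where "e = {Inl i, Inl (m + 1)}" "1 \<le> i" "i \<le> m" | i where "e = {Inl i, Inr i}" "i \<in> L"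
          using e unfolding H(2) by blast
        then show ?thesis
        proof cases
          case (1 i)
          then have "i \<in> {1..m + 1}" "m + 1 \<in> {1..m + 1}" by simp_all
          then show ?thesis unfolding H(1) 1(1) by blast
        next
          case (2 i)
          then have "i \<in> {1..m + 1}" using H(3) by blast
          then show ?thesis unfolding H(1) 2(1) using 2(2) by blast
        qed
      qed
      obtain u where "spider_at G u"
        using spider_at_iso[OF iso sub spider_at_attach_pendants[OF L(1)]] by blast
      then show ?thesis by (rule exchange_spider[OF assms])
    qed
    then show "\<forall>c. (\<forall>v\<in>verts G. 0 < c v) \<longrightarrow> exchange_property G c" by blast
  qed
qed

end
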